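(* Let $\rho>1/2$ and $\epsilon>0$ be real, let $\mu=\mu_R+i\mu_I$ be any complex number ($\mu_R,\mu_I\in\mathbb{R}$), and let $z=te^{i\theta}$ be any complex number with $t=|z|>0$ and $\theta\in\mathbb{R}$ satisfying $$\frac{\pi}{2\rho}-\delta_\rho+\pi<\theta<-\frac{\pi}{2\rho}+\delta_\rho+\pi,$$ where the real parameter $\delta_\rho$ is as specified in each item below. Then the following hold for the Mittag-Leffler function $E_{\rho,\mu}(z)=\sum_{k=0}^\infty \frac{z^k}{\Gamma(\mu+k/\rho)}$. 1) For any real $\delta_\rho$ satisfying $\frac{\pi}{2\rho}<\delta_\rho\le\min\left(\pi,\frac{\pi}{\rho}\right)$, $$E_{\rho,\mu}(z)=\int_{1+\epsilon}^{\infty}K^{Re}_{\rho,\mu}(r,\delta_\rho,t,\theta)\,dr+\int_{-\delta_\rho-\pi}^{\delta_\rho-\pi}P^{Re}_{\rho,\mu}(1+\epsilon,\varphi,t,\theta)\,d\varphi$$ $$\qquad+i\left\{\int_{1+\epsilon}^{\infty}K^{Im}_{\rho,\mu}(r,\delta_\rho,t,\theta)\,dr+\int_{-\delta_\rho-\pi}^{\delta_\rho-\pi}P^{Im}_{\rho,\mu}(1+\epsilon,\varphi,t,\theta)\,d\varphi\right\},$$ where $$K^{Re}_{\rho,\mu}(r,\delta_\rho,t,\theta)=\frac{\rho}{2\pi}\,\frac{(tr)^{\rho(1-\mu_R)}}{r^2+2r\cos\delta_\rho+1}$$ $$\times\Big[f(r,\delta_\rho-\pi,t,\theta)\big(r\sin(\xi(r,\delta_\rho-\pi,t,\theta))+\sin(\xi(r,\delta_\rho-\pi,t,\theta)+\delta_\rho)\big)$$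 $$-f(r,-\delta_\rho-\pi,t,\theta)\big(r\sin(\xi(r,-\delta_\rho-\pi,t,\theta))+\sin(\xi(r,-\delta_\rho-\pi,t,\theta)-\delta_\rho)\big)\Big],$$ $$K^{Im}_{\rho,\mu}(r,\delta_\rho,t,\theta)=\frac{\rho}{2\pi}\,\frac{(tr)^{\rho(1-\mu_R)}}{r^2+2r\cos\delta_\rho+1}$$ $$\times\Big[f(r,-\delta_\rho-\pi,t,\theta)\big(r\cos(\xi(r,-\delta_\rho-\pi,t,\theta))+\cos(\xi(r,-\delta_\rho-\pi,t,\theta)-\delta_\rho)\big)$$ $$-f(r,\delta_\rho-\pi,t,\theta)\big(r\cos(\xi(r,\delta_\rho-\pi,t,\theta))+\cos(\xi(r,\delta_\rho-\pi,t,\theta)+\delta_\rho)\big)\Big].$$ 2) If $\rho\ge 1$ and $\delta_\rho=\pi/\rho$, then $$E_{\rho,\mu}(z)=\int_{1+\epsilon}^{\infty}K^{Re}_{\rho,\mu}(r,t,\theta)\,dr+\int_{-\frac{\pi}{\rho}-\pi}^{\frac{\pi}{\rho}-\pi}P^{Re}_{\rho,\mu}(1+\epsilon,\varphi,t,\theta)\,d\varphi$$ $$\qquad+i\left\{\int_{1+\epsilon}^{\infty}K^{Im}_{\rho,\mu}(r,t,\theta)\,dr+\int_{-\frac{\pi}{\rho}-\pi}^{\frac{\pi}{\rho}-\pi}P^{Im}_{\rho,\mu}(1+\epsilon,\varphi,t,\theta)\,d\varphi\right\},$$ where $$K^{Re}_{\rho,\mu}(r,t,\theta)=\frac{\rho}{2\pi}\,\frac{(tr)^{\rho(1-\mu_R)}e^{\varrho(r,t,\theta)}}{r^2+2r\cos(\pi/\rho)+1}$$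 $$\times\Big[e^{\mu_I\pi}\big(r\sin(\xi'(r,t,\theta)+(1-\mu_R)\pi)+\sin(\xi'(r,t,\theta)+(1-\mu_R)\pi+\pi/\rho)\big)$$ $$-e^{-\mu_I\pi}\big(r\sin(\xi'(r,t,\theta)-(1-\mu_R)\pi)+\sin(\xi'(r,t,\theta)-(1-\mu_R)\pi-\pi/\rho)\big)\Big],$$ $$K^{Im}_{\rho,\mu}(r,t,\theta)=\frac{\rho}{2\pi}\,\frac{(tr)^{\rho(1-\mu_R)}e^{\varrho(r,t,\theta)}}{r^2+2r\cos(\pi/\rho)+1}$$ $$\times\Big[e^{-\mu_I\pi}\big(r\cos(\xi'(r,t,\theta)-(1-\mu_R)\pi)+\cos(\xi'(r,t,\theta)-(1-\mu_R)\pi-\pi/\rho)\big)$$ $$-e^{\mu_I\pi}\big(r\cos(\xi'(r,t,\theta)+(1-\mu_R)\pi)+\cos(\xi'(r,t,\theta)+(1-\mu_R)\pi+\pi/\rho)\big)\Big],$$ with $$\varrho(r,t,\theta)=-(tr)^\rho\cos(\rho(\theta-\pi))+\rho\mu_I(\theta-\pi),$$ $$\xi'(r,t,\theta)=-(tr)^\rho\sin(\rho(\theta-\pi))+\rho(1-\mu_R)(\theta-\pi)-\rho\mu_I\ln(tr).$$ In both items $P^{Re}_{\rho,\mu}$, $P^{Im}_{\rho,\mu}$, $f$ and $\xi$ are the functions defined in the context.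
   Context: The two-parameter Mittag-Leffler function is $E_{\rho,\mu}(z)=\sum_{k=0}^{\infty}\frac{z^k}{\Gamma(\mu+k/\rho)}$ for $\rho>0$, $\mu\in\mathbb{C}$, $z\in\mathbb{C}$, where $1/\Gamma$ is understood to be $0$ at the poles of $\Gamma$. Functions denoted by the same letter $K$ are distinguished by their number of arguments. Define, for $\mu=\mu_R+i\mu_I$, $$f(r,\varphi,t,\theta)=\exp\{(tr)^\rho\cos(\rho(\theta+\varphi))+\rho\mu_I(\theta+\varphi)\},$$ $$\xi(r,\varphi,t,\theta)=(tr)^\rho\sin(\rho(\theta+\varphi))+\rho(1-\mu_R)(\theta+\varphi)-\rho\mu_I\ln(tr),$$ $$P^{Re}_{\rho,\mu}(r,\varphi,t,\theta)=\frac{\rho}{2\pi}\,\frac{(tr)^{\rho(1-\mu_R)}\,r\,f(r,\varphi,t,\theta)}{r^2-2r\cos\varphi+1}\big(r\cos(\xi(r,\varphi,t,\theta))-\cos(\xi(r,\varphi,t,\theta)+\varphi)\big),$$ $$P^{Im}_{\rho,\mu}(r,\varphi,t,\theta)=\frac{\rho}{2\pi}\,\frac{(tr)^{\rho(1-\mu_R)}\,r\,f(r,\varphi,t,\theta)}{r^2-2r\cos\varphi+1}\big(r\sin(\xi(r,\varphi,t,\theta))-\sin(\xi(r,\varphi,t,\theta)+\varphi)\big).$$ *)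

theory Defs
  imports "HOL-Analysis.Analysis"
begin

(* rGamma is the entire function 1/Gamma, which vanishes at the poles of Gamma. *)
definition mittag_leffler :: "real \<Rightarrow> complex \<Rightarrow> complex \<Rightarrow> complex"
  where "mittag_leffler \<rho> \<mu> z = (\<Sum>k. z ^ k * rGamma (\<mu> + complex_of_real (real k / \<rho>)))"

(* With w = t * r * exp (i * (\<theta> + \<phi>)), ml_f is the modulus of
   exp (w powr \<rho>) * w powr (\<rho> * (1 - \<mu>)) without the factor (t * r) powr (\<rho> * (1 - Re \<mu>)),
   and ml_xi is the argument, both along the branch arg w = \<theta> + \<phi> (not the principal one). *)
definition ml_f :: "real \<Rightarrow> complex \<Rightarrow> real \<Rightarrow> real \<Rightarrow> real \<Rightarrow> real \<Rightarrow> real"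
  where "ml_f \<rho> \<mu> r \<phi> t \<theta> =
    exp ((t * r) powr \<rho> * cos (\<rho> * (\<theta> + \<phi>)) + \<rho> * Im \<mu> * (\<theta> + \<phi>))"

definition ml_xi :: "real \<Rightarrow> complex \<Rightarrow> real \<Rightarrow> real \<Rightarrow> real \<Rightarrow> real \<Rightarrow> real"
  where "ml_xi \<rho> \<mu> r \<phi> t \<theta> =
    (t * r) powr \<rho> * sin (\<rho> * (\<theta> + \<phi>)) + \<rho> * (1 - Re \<mu>) * (\<theta> + \<phi>) - \<rho> * Im \<mu> * ln (t * r)"

definition P_Re :: "real \<Rightarrow> complex \<Rightarrow> real \<Rightarrow> real \<Rightarrow> real \<Rightarrow> real \<Rightarrow> real"
  where "P_Re \<rho> \<mu> r \<phi> t \<theta> =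
    \<rho> / (2 * pi) *
    ((t * r) powr (\<rho> * (1 - Re \<mu>)) * r * ml_f \<rho> \<mu> r \<phi> t \<theta> / (r\<^sup>2 - 2 * r * cos \<phi> + 1)) *
    (r * cos (ml_xi \<rho> \<mu> r \<phi> t \<theta>) - cos (ml_xi \<rho> \<mu> r \<phi> t \<theta> + \<phi>))"

definition P_Im :: "real \<Rightarrow> complex \<Rightarrow> real \<Rightarrow> real \<Rightarrow> real \<Rightarrow> real \<Rightarrow> real"
  where "P_Im \<rho> \<mu> r \<phi> t \<theta> =
    \<rho> / (2 * pi) *
    ((t * r) powr (\<rho> * (1 - Re \<mu>)) * r * ml_f \<rho> \<mu> r \<phi> t \<theta> / (r\<^sup>2 - 2 * r * cos \<phi> + 1)) *
    (r * sin (ml_xi \<rho> \<mu> r \<phi> t \<theta>) - sin (ml_xi \<rho> \<mu> r \<phi> t \<theta> + \<phi>))"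

definition K_Re :: "real \<Rightarrow> complex \<Rightarrow> real \<Rightarrow> real \<Rightarrow> real \<Rightarrow> real \<Rightarrow> real"
  where "K_Re \<rho> \<mu> r \<delta> t \<theta> =
    \<rho> / (2 * pi) * ((t * r) powr (\<rho> * (1 - Re \<mu>)) / (r\<^sup>2 + 2 * r * cos \<delta> + 1)) *
    (ml_f \<rho> \<mu> r (\<delta> - pi) t \<theta> *
       (r * sin (ml_xi \<rho> \<mu> r (\<delta> - pi) t \<theta>) + sin (ml_xi \<rho> \<mu> r (\<delta> - pi) t \<theta> + \<delta>))
     - ml_f \<rho> \<mu> r (- \<delta> - pi) t \<theta> *
       (r * sin (ml_xi \<rho> \<mu> r (- \<delta> - pi) t \<theta>) + sin (ml_xi \<rho> \<mu> r (- \<delta> - pi) t \<theta> - \<delta>)))"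

definition K_Im :: "real \<Rightarrow> complex \<Rightarrow> real \<Rightarrow> real \<Rightarrow> real \<Rightarrow> real \<Rightarrow> real"
  where "K_Im \<rho> \<mu> r \<delta> t \<theta> =
    \<rho> / (2 * pi) * ((t * r) powr (\<rho> * (1 - Re \<mu>)) / (r\<^sup>2 + 2 * r * cos \<delta> + 1)) *
    (ml_f \<rho> \<mu> r (- \<delta> - pi) t \<theta> *
       (r * cos (ml_xi \<rho> \<mu> r (- \<delta> - pi) t \<theta>) + cos (ml_xi \<rho> \<mu> r (- \<delta> - pi) t \<theta> - \<delta>))
     - ml_f \<rho> \<mu> r (\<delta> - pi) t \<theta> *
       (r * cos (ml_xi \<rho> \<mu> r (\<delta> - pi) t \<theta>) + cos (ml_xi \<rho> \<mu> r (\<delta> - pi) t \<theta> + \<delta>)))"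

(* ml_varrho, ml_xi', K_Re' and K_Im' belong to the case \<delta> = pi / \<rho>. *)
definition ml_varrho :: "real \<Rightarrow> complex \<Rightarrow> real \<Rightarrow> real \<Rightarrow> real \<Rightarrow> real"
  where "ml_varrho \<rho> \<mu> r t \<theta> =
    - ((t * r) powr \<rho>) * cos (\<rho> * (\<theta> - pi)) + \<rho> * Im \<mu> * (\<theta> - pi)"

definition ml_xi' :: "real \<Rightarrow> complex \<Rightarrow> real \<Rightarrow> real \<Rightarrow> real \<Rightarrow> real"
  where "ml_xi' \<rho> \<mu> r t \<theta> =
    - ((t * r) powr \<rho>) * sin (\<rho> * (\<theta> - pi)) + \<rho> * (1 - Re \<mu>) * (\<theta> - pi) - \<rho> * Im \<mu> * ln (t * r)"

definition K_Re' :: "real \<Rightarrow> complex \<Rightarrow> real \<Rightarrow> real \<Rightarrow> real \<Rightarrow> real"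
  where "K_Re' \<rho> \<mu> r t \<theta> =
    \<rho> / (2 * pi) *
    ((t * r) powr (\<rho> * (1 - Re \<mu>)) * exp (ml_varrho \<rho> \<mu> r t \<theta>) / (r\<^sup>2 + 2 * r * cos (pi / \<rho>) + 1)) *
    (exp (Im \<mu> * pi) *
       (r * sin (ml_xi' \<rho> \<mu> r t \<theta> + (1 - Re \<mu>) * pi)
        + sin (ml_xi' \<rho> \<mu> r t \<theta> + (1 - Re \<mu>) * pi + pi / \<rho>))
     - exp (- Im \<mu> * pi) *
       (r * sin (ml_xi' \<rho> \<mu> r t \<theta> - (1 - Re \<mu>) * pi)
        + sin (ml_xi' \<rho> \<mu> r t \<theta> - (1 - Re \<mu>) * pi - pi / \<rho>)))"

definition K_Im' :: "real \<Rightarrow> complex \<Rightarrow> real \<Rightarrow> real \<Rightarrow> real \<Rightarrow> real"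
  where "K_Im' \<rho> \<mu> r t \<theta> =
    \<rho> / (2 * pi) *
    ((t * r) powr (\<rho> * (1 - Re \<mu>)) * exp (ml_varrho \<rho> \<mu> r t \<theta>) / (r\<^sup>2 + 2 * r * cos (pi / \<rho>) + 1)) *
    (exp (- Im \<mu> * pi) *
       (r * cos (ml_xi' \<rho> \<mu> r t \<theta> - (1 - Re \<mu>) * pi)
        + cos (ml_xi' \<rho> \<mu> r t \<theta> - (1 - Re \<mu>) * pi - pi / \<rho>))
     - exp (Im \<mu> * pi) *
       (r * cos (ml_xi' \<rho> \<mu> r t \<theta> + (1 - Re \<mu>) * pi)
        + cos (ml_xi' \<rho> \<mu> r t \<theta> + (1 - Re \<mu>) * pi + pi / \<rho>)))"

end

theory Submission
  imports Defs "HOL-Complex_Analysis.Cauchy_Integral_Theorem" "HOL-Real_Asymp.Real_Asymp"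
begin

text \<open>
  Put $u = (z\zeta)^\rho$ with $\zeta = r e^{i\varphi}$ on the branch of argument $\theta + \varphi$.
  In complex form (lemmas \<open>Complex_K_eq\<close> and \<open>Complex_P_eq\<close>) the right-hand side is the integral
  $\frac{\rho}{2\pi i}\int e^u u^{1-\mu}\,\frac{d\zeta}{\zeta - 1}$ over the contour that comes from
  infinity on the ray $\varphi = -\delta-\pi$, follows the arc of radius $1 + \epsilon$, and leaves on
  the ray $\varphi = \delta-\pi$.

  On this contour $|\zeta| \ge 1 + \epsilon$, so $1/(\zeta-1) = \sum_k \zeta^{-k-1}$ may be integrated
  term by term by dominated convergence (\<open>integral_cauchy_kernel_sums\<close>). Since
  $d\zeta/\zeta = du/(\rho u)$ and $\zeta^{-k} = z^k u^{-k/\rho}$, the term of index $k$ is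
  $z^k$ times $\frac{1}{2\pi i}\int e^u u^{-(\mu + k/\rho)}\,du$. The conditions on $\theta$ and
  $\delta$ say that the two ends of the $u$-contour leave in the sectors where $e^u$ decays, so Hankel's
  formula (\<open>hankel_limit\<close>) evaluates this integral to $1/\Gamma(\mu + k/\rho)$, and the sum is the
  Mittag-Leffler series. No residues enter.

  Hankel's formula is proved in the coordinate $s = \log u$, where the integrand is entire and has
  a primitive. For $\mathrm{Re}\,a < 1$ it follows from the Euler integral and the reflection formula,
  for $a = 1$ by direct inspection, and the recurrence $1/\Gamma(a) = a/\Gamma(a+1)$, valid for both
  sides, extends it to all $a$.
\<close>

section \<open>Hankel's formula for the reciprocal Gamma function\<close>

text \<open>The Hankel integrand $e^u u^{-a}\,du$ in the logarithmic coordinate \<open>u = exp s\<close>. It is entire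
  in \<open>s\<close>, and the sheet of $u^{-a}$ is selected by the imaginary part of \<open>s\<close>, so no branch cuts
  appear.\<close>

definition hankel_kernel :: "complex \<Rightarrow> complex \<Rightarrow> complex"
  where "hankel_kernel a s = exp (exp s + (1 - a) * s)"

text \<open>A primitive replaces contour integrals: the integral along any path is a difference of its end
  values, so deforming a contour needs no further argument.\<close>

lemma hankel_kernel_primitive:
  obtains \<Psi> where "\<And>s. (\<Psi> has_field_derivative hankel_kernel a s) (at s)"
proof -
  have "hankel_kernel a holomorphic_on UNIV"
    unfolding hankel_kernel_def by (intro holomorphic_intros)
  from holomorphic_convex_primitive'[OF convex_UNIV open_UNIV this] that
  show ?thesis by (metis UNIV_I)
qed

lemma norm_hankel_kernel:
  "cmod (hankel_kernel a (Complex x \<tau>)) =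
     exp (exp x * cos \<tau> + (1 - Re a) * x + Im a * \<tau>)"
  by (simp add: hankel_kernel_def norm_exp_eq_Re Re_exp)

text \<open>The increment of \<open>f\<close> over the vertical segment with abscissa \<open>x\<close> is bounded by its length times
  a bound of the derivative there. The filter is left open since it is used both for
  \<open>x \<longlongrightarrow> \<infinity>\<close> and for \<open>x \<longlongrightarrow> -\<infinity>\<close>.\<close>

lemma vertical_increment_tendsto_0:
  fixes f f' :: "complex \<Rightarrow> complex"
  assumes df: "\<And>s. (f has_field_derivative f' s) (at s)"
    and bound: "eventually (\<lambda>x. \<forall>\<tau>\<in>closed_segment b b'. cmod (f' (Complex x \<tau>)) \<le> B x) F"
    and B: "(B \<longlongrightarrow> 0) F"
  shows "((\<lambda>x. f (Complex x b) - f (Complex x b')) \<longlongrightarrow> 0) F"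
proof (rule Lim_null_comparison)
  show "((\<lambda>x. B x * \<bar>b - b'\<bar>) \<longlongrightarrow> 0) F"
    using tendsto_mult_left_zero[OF B] .
  show "\<forall>\<^sub>F x in F. cmod (f (Complex x b) - f (Complex x b')) \<le> B x * \<bar>b - b'\<bar>"
    using bound
  proof eventually_elim
    case (elim x)
    let ?S = "Complex x ` closed_segment b b'"
    have "?S = Re -` {x} \<inter> Im -` closed_segment b b'"
      by (auto simp: image_iff complex_eq_iff)
    also have "convex \<dots>"
      by (intro convex_Int convex_linear_vimage bounded_linear.linear bounded_linear_Re
          bounded_linear_Im convex_singleton convex_closed_segment)
    finally have conv: "convex ?S" .
    have "cmod (f (Complex x b) - f (Complex x b')) \<le> B x * cmod (Complex x b - Complex x b')"
    proof (rule field_differentiable_bound[where S = ?S and f' = f'])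
      show "convex ?S" by (fact conv)
      show "\<And>z. z \<in> ?S \<Longrightarrow> (f has_field_derivative f' z) (at z within ?S)"
        using df has_field_derivative_at_within by blast
      show "\<And>z. z \<in> ?S \<Longrightarrow> cmod (f' z) \<le> B x" using elim by auto
    qed auto
    also have "cmod (Complex x b - Complex x b') = \<bar>b - b'\<bar>"
      by (simp add: cmod_def)
    finally show ?case .
  qed
qed

lemma abs_le_closed_segment:
  fixes \<tau> b b' :: real
  assumes "\<tau> \<in> closed_segment b b'"
  shows "\<bar>\<tau>\<bar> \<le> \<bar>b\<bar> + \<bar>b'\<bar>"
  using assms by (auto simp: closed_segment_eq_real_ivl split: if_splits)

lemma norm_hankel_kernel_le:
  assumes \<tau>: "\<tau> \<in> closed_segment b b'" and c: "cos \<tau> \<le> c"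
  shows "cmod (hankel_kernel a (Complex x \<tau>))
    \<le> exp (c * exp x + (1 - Re a) * x + \<bar>Im a\<bar> * (\<bar>b\<bar> + \<bar>b'\<bar>))"
proof -
  have "Im a * \<tau> \<le> \<bar>Im a\<bar> * \<bar>\<tau>\<bar>" by (metis abs_ge_self abs_mult)
  also have "\<dots> \<le> \<bar>Im a\<bar> * (\<bar>b\<bar> + \<bar>b'\<bar>)"
    by (intro mult_left_mono abs_le_closed_segment \<tau>) auto
  finally show ?thesis
    using c unfolding norm_hankel_kernel by (simp add: mult.commute add_mono)
qed

lemma cos_neg_between_pi_half:
  fixes \<tau> :: real
  assumes "pi / 2 < \<tau>" "\<tau> < 3 * pi / 2"
  shows "cos \<tau> < 0"
  using cos_gt_zero_pi[of "\<tau> - pi"] assms by simp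

lemma exp_minus_exp_tendsto_0:
  fixes \<kappa> B C :: real
  assumes "\<kappa> > 0"
  shows "((\<lambda>x. exp (- \<kappa> * exp x + B * x + C)) \<longlongrightarrow> 0) at_top"
  using assms by real_asymp

text \<open>The directions in which the two ends of a Hankel contour leave do not matter as long as they stay
  in the sector where $e^u$ decays.\<close>

lemma hankel_primitive_shift:
  assumes prim: "\<And>s. (\<Psi> has_field_derivative hankel_kernel a s) (at s)"
    and neg: "\<And>\<tau>. \<tau> \<in> closed_segment b b' \<Longrightarrow> cos \<tau> < 0"
  shows "((\<lambda>x. \<Psi> (Complex x b) - \<Psi> (Complex x b')) \<longlongrightarrow> 0) at_top"
proof -
  have "\<exists>u\<in>closed_segment b b'. \<forall>\<tau>\<in>closed_segment b b'. cos \<tau> \<le> cos u"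
    by (intro continuous_attains_sup continuous_intros) auto
  then obtain u where u: "u \<in> closed_segment b b'" "\<And>\<tau>. \<tau> \<in> closed_segment b b' \<Longrightarrow> cos \<tau> \<le> cos u"
    by blast
  define \<kappa> where "\<kappa> = - cos u"
  have \<kappa>: "\<kappa> > 0" using neg u(1) by (auto simp: \<kappa>_def)
  show ?thesis
  proof (rule vertical_increment_tendsto_0[OF prim])
    show "((\<lambda>x. exp (- \<kappa> * exp x + (1 - Re a) * x + \<bar>Im a\<bar> * (\<bar>b\<bar> + \<bar>b'\<bar>))) \<longlongrightarrow> 0) at_top"
      using \<kappa> by (rule exp_minus_exp_tendsto_0)
    show "\<forall>\<^sub>F x in at_top. \<forall>\<tau>\<in>closed_segment b b'. cmod (hankel_kernel a (Complex x \<tau>))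
        \<le> exp (- \<kappa> * exp x + (1 - Re a) * x + \<bar>Im a\<bar> * (\<bar>b\<bar> + \<bar>b'\<bar>))"
      unfolding \<kappa>_def minus_minus
      by (intro always_eventually allI ballI norm_hankel_kernel_le u)
  qed
qed

lemma integral_to_inf_tendsto:
  fixes f :: "real \<Rightarrow> complex"
  assumes "f absolutely_integrable_on {a..}"
  shows "((\<lambda>R. integral {a..R} f) \<longlongrightarrow> integral {a..} f) at_top"
proof -
  have sub: "f absolutely_integrable_on {a..R}" for R
    by (rule absolutely_integrable_on_subinterval[OF assms, unfolded box_real]) auto
  have "((\<lambda>R. set_lebesgue_integral lebesgue {a..R} f) \<longlongrightarrow> set_lebesgue_integral lebesgue {a..} f) at_top"
    using assms by (intro tendsto_set_lebesgue_integral_at_top) auto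
  then show ?thesis
    by (simp add: set_lebesgue_integral_eq_integral(2) assms sub)
qed

text \<open>The two edges of the cut along the negative real axis of the \<open>u\<close>-plane: at \<open>u = -v\<close> the
  contributions of the arguments \<open>pi\<close> and \<open>-pi\<close> combine to
  $2 i \sin(\pi a)\, e^{-v} v^{-a}$.\<close>

lemma hankel_pi_derivative:
  assumes prim: "\<And>s. (\<Psi> has_field_derivative hankel_kernel a s) (at s)" and v: "v > 0"
  shows "((\<lambda>v. \<Psi> (Complex (ln v) pi) - \<Psi> (Complex (ln v) (- pi))) has_vector_derivative
           2 * \<i> * sin (of_real pi * a) * (of_real v powr (- a) / of_real (exp v))) (at v)"
proof -
  have 1: "((\<lambda>v. \<Psi> (Complex (ln v) c)) has_vector_derivative
        (1 / v) *\<^sub>R hankel_kernel a (Complex (ln v) c)) (at v)" for c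
  proof -
    have "((\<lambda>v. of_real (ln v) + \<i> * of_real c) has_vector_derivative of_real (1 / v)) (at v)"
      using v by (auto intro!: derivative_eq_intros has_vector_derivative_of_real
          simp: field_simps  simp flip: has_real_derivative_iff_has_vector_derivative)
    moreover have "(\<lambda>v. of_real (ln v) + \<i> * of_real c) = (\<lambda>v. Complex (ln v) c)"
      by (auto simp: complex_eq_iff)
    ultimately have "((\<lambda>v. Complex (ln v) c) has_vector_derivative of_real (1 / v)) (at v)" by simp
    from field_vector_diff_chain_at[OF this prim] show ?thesis
      by (simp add: o_def scaleR_conv_of_real)
  qed
  have 2: "hankel_kernel a (Complex (ln v) c) / of_real v = 
      of_real v powr (- a) / of_real (exp v) * exp (\<i> * c * (1 - a))" if c: "cos c = -1" "sin c = 0" for c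
  proof -
    have "exp (Complex (ln v) c) = - of_real v" using v c by (simp add: exp_eq_polar complex_eq_iff)
    then have "hankel_kernel a (Complex (ln v) c) = exp (- of_real v) * exp ((1 - a) * Complex (ln v) c)"
      unfolding hankel_kernel_def exp_add by simp
    also have "(1 - a) * Complex (ln v) c = of_real (ln v) + - a * of_real (ln v) + \<i> * c * (1 - a)"
      by (simp add: complex_eq_iff algebra_simps)
    also have "exp \<dots> = of_real v * of_real v powr (-a) * exp (\<i> * c * (1 - a))"
      using v unfolding exp_add powr_def by (simp add: Ln_of_real exp_of_real)
    finally show ?thesis using v by (simp add: exp_minus exp_of_real field_simps)
  qed
  have 3: "exp (\<i> * of_real pi * (1 - a)) - exp (\<i> * of_real (- pi) * (1 - a)) = 2 * \<i> * sin (of_real pi * a)"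
  proof -
    have "exp (\<i> * of_real pi * (1 - a)) = exp (\<i> * of_real pi + - (\<i> * (of_real pi * a)))"
      "exp (\<i> * of_real (- pi) * (1 - a)) = exp (- (\<i> * of_real pi) + \<i> * (of_real pi * a))"
      by (simp_all add: algebra_simps)
    then have "exp (\<i> * of_real pi * (1 - a)) = - exp (- (\<i> * (of_real pi * a)))"
      "exp (\<i> * of_real (- pi) * (1 - a)) = - exp (\<i> * (of_real pi * a))"
      unfolding exp_add by (simp_all add: exp_minus[of "\<i> * of_real pi"])
    then show ?thesis by (simp add: sin_exp_eq')
  qed
  have "((\<lambda>v. \<Psi> (Complex (ln v) pi) - \<Psi> (Complex (ln v) (- pi))) has_vector_derivative
        (1 / v) *\<^sub>R hankel_kernel a (Complex (ln v) pi) -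
          (1 / v) *\<^sub>R hankel_kernel a (Complex (ln v) (-pi))) (at v)"
    by (intro derivative_intros 1)
  also have "(1 / v) *\<^sub>R hankel_kernel a (Complex (ln v) pi) -
          (1 / v) *\<^sub>R hankel_kernel a (Complex (ln v) (-pi)) = 
     of_real v powr (- a) / of_real (exp v) * 
      (exp (\<i> * of_real pi * (1 - a)) - exp (\<i> * of_real (- pi) * (1 - a)))"
    using 2[of pi] 2[of "-pi"] by (simp add: scaleR_conv_of_real algebra_simps divide_inverse)
  finally show ?thesis unfolding 3 by (simp add: mult_ac)
qed

text \<open>For \<open>Re a < 1\<close> the contour can be collapsed onto the cut: nothing is left from the circle around
  \<open>0\<close>, and the edges give the Euler integral of \<open>Gamma (1 - a)\<close>. The reflection formula turns
  \<open>sin (pi * a) * Gamma (1 - a)\<close> into \<open>pi * rGamma a\<close>.\<close>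

lemma hankel_limit_Re_less_1:
  assumes prim: "\<And>s. (\<Psi> has_field_derivative hankel_kernel a s) (at s)" and a: "Re a < 1"
  shows "((\<lambda>x. \<Psi> (Complex x pi) - \<Psi> (Complex x (- pi))) \<longlongrightarrow> 2 * \<i> * pi * rGamma a) at_top"
proof -
  define D where "D x = \<Psi> (Complex x pi) - \<Psi> (Complex x (- pi))" for x
  have D0: "(D \<longlongrightarrow> 0) at_bot"
    unfolding D_def
  proof (rule vertical_increment_tendsto_0[OF prim])
    show "((\<lambda>x. exp (1 * exp x + (1 - Re a) * x + \<bar>Im a\<bar> * (\<bar>pi\<bar> + \<bar>-pi\<bar>))) \<longlongrightarrow> 0) at_bot"
    proof -
      define c d where "c = 1 - Re a" and "d = \<bar>Im a\<bar> * (\<bar>pi\<bar> + \<bar>-pi\<bar>)"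
      have "c > 0" using a by (simp add: c_def)
      then have "((\<lambda>x. exp (exp x + c * x + d)) \<longlongrightarrow> 0) at_bot" by real_asymp
      then show ?thesis by (simp add: c_def d_def)
    qed
    show "\<forall>\<^sub>F x in at_bot. \<forall>\<tau>\<in>closed_segment pi (-pi). cmod (hankel_kernel a (Complex x \<tau>))
        \<le> exp (1 * exp x + (1 - Re a) * x + \<bar>Im a\<bar> * (\<bar>pi\<bar> + \<bar>-pi\<bar>))"
      by (intro always_eventually allI ballI norm_hankel_kernel_le) auto
  qed
  \<comment> \<open>The boundary difference as a function of \<open>v = exp x\<close>, extended continuously by \<open>0\<close> at \<open>v = 0\<close>.\<close>
  define E where "E v = (if v \<le> 0 then 0 else D (ln v))" for v
  define e where "e v = 2 * \<i> * sin (of_real pi * a) * (of_real v powr (- a) / of_real (exp v))" for v :: real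
  have dE: "(E has_vector_derivative e v) (at v)" if "v > 0" for v
  proof -
    have "((\<lambda>v. D (ln v)) has_vector_derivative e v) (at v)"
      unfolding D_def e_def using hankel_pi_derivative[OF prim that] .
    then show ?thesis
      by (rule has_vector_derivative_transform_within_open[OF _ open_greaterThan[of 0]])
        (use that in \<open>auto simp: E_def\<close>)
  qed
  have E0: "(E \<longlongrightarrow> 0) (at_right 0)"
  proof -
    have "((\<lambda>v. D (ln v)) \<longlongrightarrow> 0) (at_right 0)"
      using filterlim_compose[OF D0 ln_at_0] .
    then show ?thesis
    proof (rule Lim_transform_eventually)
      show "\<forall>\<^sub>F v in at_right 0. D (ln v) = E v"
        using eventually_at_right_less[of 0] by (rule eventually_mono) (simp add: E_def)
    qed
  qed
  have int: "(e has_integral E R) {0..R}" if "R \<ge> 0" for R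
  proof -
    have "(e has_integral (E R - E 0)) {0..R}"
    proof (rule fundamental_theorem_of_calculus_interior[OF that])
      show "continuous_on {0..R} E"
        unfolding continuous_on_def
      proof
        fix v assume v: "v \<in> {0..R}"
        show "(E \<longlongrightarrow> E v) (at v within {0..R})"
        proof (cases "v = 0")
          case True
          have "(E \<longlongrightarrow> 0) (at 0 within {0..})"
            using E0 by (simp add: at_within_Ici_at_right)
          then have "(E \<longlongrightarrow> 0) (at 0 within {0..R})"
            by (rule tendsto_within_subset) auto
          then show ?thesis using True by (simp add: E_def)
        next
          case False
          then have "isCont E v" using v dE[of v] has_vector_derivative_continuous by fastforce
          then show ?thesis unfolding continuous_at by (rule filterlim_mono) (auto simp: at_le)
        qed
      qed
    qed (use dE in auto)
    then show ?thesis by (simp add: E_def)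
  qed
  have "(\<lambda>t. complex_of_real t powr (1 - a - 1) / complex_of_real (exp t)) absolutely_integrable_on {0<..}"
    using a by (intro absolutely_integrable_Gamma_integral') simp
  then have "(\<lambda>t. complex_of_real t powr (1 - a - 1) / complex_of_real (exp t)) absolutely_integrable_on {0..}"
    by (rule absolutely_integrable_spike_set)
      (auto intro: negligible_subset[of "{0}"])
  then have abs: "e absolutely_integrable_on {0..}"
    unfolding e_def by (intro set_integrable_mult_right) auto
  have "((\<lambda>t. of_real t powr (1 - a - 1) / of_real (exp t)) has_integral Gamma (1 - a)) {0..}"
    using a by (intro Gamma_integral_complex) simp
  then have "integral {0..} e = 2 * \<i> * sin (of_real pi * a) * Gamma (1 - a)"
    unfolding e_def by (intro integral_unique has_integral_mult_right) simp
  also have "\<dots> = 2 * \<i> * pi * (rGamma a * rGamma (1 - a)) * Gamma (1 - a)"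
    by (simp add: rGamma_reflection_complex)
  also have "\<dots> = 2 * \<i> * pi * rGamma a"
  proof -
    have "1 - a \<notin> \<int>\<^sub>\<le>\<^sub>0"
      using a by (auto elim!: nonpos_Ints_cases simp: complex_eq_iff)
    then have "rGamma (1 - a) * Gamma (1 - a) = 1"
      by (simp add: rGamma_inverse_Gamma Gamma_eq_zero_iff)
    then show ?thesis by (simp add: mult.assoc)
  qed
  finally have "((\<lambda>R. integral {0..R} e) \<longlongrightarrow> 2 * \<i> * pi * rGamma a) at_top"
    using integral_to_inf_tendsto[OF abs] by simp
  then have "((\<lambda>R. D (ln R)) \<longlongrightarrow> 2 * \<i> * pi * rGamma a) at_top"
  proof (rule Lim_transform_eventually)
    show "\<forall>\<^sub>F R in at_top. integral {0..R} e = D (ln R)"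
      using eventually_gt_at_top[of 0]
    proof eventually_elim
      case (elim R)
      then show ?case using integral_unique[OF int[of R]] by (simp add: E_def)
    qed
  qed
  from filterlim_compose[OF this exp_at_top] show ?thesis by (simp add: D_def)
qed

text \<open>For \<open>a = 1\<close> the two edges cancel, and the circle around \<open>0\<close> alone contributes \<open>2 * pi * \<i>\<close>.
  The recurrence below cannot reach this value from \<open>a = 0\<close>.\<close>

lemma hankel_limit_1:
  assumes prim: "\<And>s. (\<Psi> has_field_derivative hankel_kernel 1 s) (at s)"
  shows "((\<lambda>x. \<Psi> (Complex x pi) - \<Psi> (Complex x (- pi))) \<longlongrightarrow> 2 * \<i> * pi * rGamma 1) at_top"
proof -
  define D where "D x = \<Psi> (Complex x pi) - \<Psi> (Complex x (- pi))" for x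
  have D0: "(D \<longlongrightarrow> 2 * \<i> * pi) at_bot"
  proof -
    \<comment> \<open>The kernel is close to \<open>1\<close> on the far left, so increments of the primitive are close to those of the identity.\<close>
    define f where "f s = \<Psi> s - s" for s
    have df: "(f has_field_derivative exp (exp s) - 1) (at s)" for s
      unfolding f_def using prim[of s] by (auto intro!: derivative_eq_intros simp: hankel_kernel_def)
    have "((\<lambda>x. f (Complex x pi) - f (Complex x (- pi))) \<longlongrightarrow> 0) at_bot"
    proof (rule vertical_increment_tendsto_0[OF df])
      show "((\<lambda>x::real. exp (exp x) - 1) \<longlongrightarrow> 0) at_bot" by real_asymp
      have "cmod (exp w - 1) \<le> exp (cmod w) - 1" for w :: complex
      proof -
        have "(\<lambda>n. w ^ Suc n /\<^sub>R fact (Suc n)) sums (exp w - 1)"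
          using exp_converges[of w] by (subst sums_Suc_iff) simp
        moreover have "(\<lambda>n. cmod w ^ Suc n /\<^sub>R fact (Suc n)) sums (exp (cmod w) - 1)"
          using exp_converges[of "cmod w"] by (subst sums_Suc_iff) simp
        ultimately show ?thesis
          by (rule norm_sums_le) (simp add: norm_mult norm_power)
      qed
      then show "\<forall>\<^sub>F x in at_bot. \<forall>\<tau>\<in>closed_segment pi (-pi).
          cmod (exp (exp (Complex x \<tau>)) - 1) \<le> exp (exp x) - 1"
        by (intro always_eventually allI ballI) (metis complex.sel(1) norm_exp_eq_Re)
    qed
    then have "((\<lambda>x. (f (Complex x pi) - f (Complex x (- pi))) + 2 * \<i> * pi) \<longlongrightarrow> 0 + 2 * \<i> * pi) at_bot"
      by (intro tendsto_intros)
    moreover have "(f (Complex x pi) - f (Complex x (- pi))) + 2 * \<i> * pi = D x" for x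
      by (simp add: f_def D_def complex_eq_iff)
    ultimately show ?thesis by simp
  qed
  have dE: "((\<lambda>v. D (ln v)) has_vector_derivative 0) (at v)" if "v > 0" for v
    using hankel_pi_derivative[OF prim that] unfolding D_def by (simp flip: sin_of_real)
  have "\<exists>c. \<forall>v\<in>{0<..}. D (ln v) = c"
    by (rule has_vector_derivative_zero_constant[of "{0<..}"])
      (auto intro: has_vector_derivative_at_within dE)
  then obtain c where c: "\<And>v. v > 0 \<Longrightarrow> D (ln v) = c" by auto
  have Dc: "D x = c" for x using c[of "exp x"] by simp
  then have "c = 2 * \<i> * pi"
    using D0 by (simp add: tendsto_const_iff Dc[abs_def])
  then show ?thesis using Dc by (simp add: D_def)
qed

text \<open>Integration by parts gives the recurrence that \<open>rGamma_plus1\<close> states for \<open>rGamma\<close>; dividing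
  by \<open>a\<close> then propagates the limit to the right.\<close>

lemma hankel_limit_plus_1:
  assumes lim: "\<And>\<Psi>. (\<And>s. (\<Psi> has_field_derivative hankel_kernel a s) (at s)) \<Longrightarrow>
      ((\<lambda>x. \<Psi> (Complex x pi) - \<Psi> (Complex x (- pi))) \<longlongrightarrow> 2 * \<i> * pi * rGamma a) at_top"
    and prim: "\<And>s. (\<Psi> has_field_derivative hankel_kernel (a + 1) s) (at s)"
    and a: "a \<noteq> 0"
  shows "((\<lambda>x. \<Psi> (Complex x pi) - \<Psi> (Complex x (- pi))) \<longlongrightarrow> 2 * \<i> * pi * rGamma (a + 1)) at_top"
proof -
  \<comment> \<open>The boundary term of the integration by parts.\<close>
  define B where "B s = hankel_kernel (a + 1) s" for s
  have "((\<lambda>s. a * \<Psi> s + B s) has_field_derivative hankel_kernel a s) (at s)" for s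
  proof -
    have "(B has_field_derivative (exp s - a) * B s) (at s)"
      unfolding B_def hankel_kernel_def by (auto intro!: derivative_eq_intros simp: algebra_simps)
    then have "((\<lambda>s. a * \<Psi> s + B s) has_field_derivative a * hankel_kernel (a + 1) s + (exp s - a) * B s) (at s)"
      by (intro DERIV_add DERIV_cmult prim)
    moreover have "exp s * B s = hankel_kernel a s"
      unfolding B_def hankel_kernel_def exp_add[symmetric] by (simp add: algebra_simps)
    ultimately show ?thesis
      by (simp add: B_def algebra_simps)
  qed
  from lim[OF this]
  have "((\<lambda>x. a * (\<Psi> (Complex x pi) - \<Psi> (Complex x (- pi))) + (B (Complex x pi) - B (Complex x (- pi))))
     \<longlongrightarrow> 2 * \<i> * pi * rGamma a) at_top"
    by (simp add: algebra_simps)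
  moreover have B0: "((\<lambda>x. B (Complex x c)) \<longlongrightarrow> 0) at_top" if "cos c = -1" for c
  proof (rule Lim_null_comparison)
    show "\<forall>\<^sub>F x in at_top. cmod (B (Complex x c)) \<le> exp (- 1 * exp x + (- Re a) * x + Im a * c)"
      by (simp add: B_def norm_hankel_kernel that)
  qed (rule exp_minus_exp_tendsto_0, simp)
  ultimately have "((\<lambda>x. a * (\<Psi> (Complex x pi) - \<Psi> (Complex x (- pi))) + (B (Complex x pi) - B (Complex x (- pi))) -
      (B (Complex x pi) - B (Complex x (- pi))))
     \<longlongrightarrow> 2 * \<i> * pi * rGamma a - (0 - 0)) at_top"
    by (intro tendsto_diff) auto
  then have "((\<lambda>x. (a * (\<Psi> (Complex x pi) - \<Psi> (Complex x (- pi)))) / a)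
     \<longlongrightarrow> (2 * \<i> * pi * (a * rGamma (a + 1))) / a) at_top"
    using a by (intro tendsto_divide) (simp_all add: rGamma_plus1)
  then show ?thesis using a by (simp add: mult.assoc)
qed

lemma hankel_limit_pi:
  assumes "\<And>s. (\<Psi> has_field_derivative hankel_kernel a s) (at s)"
  shows "((\<lambda>x. \<Psi> (Complex x pi) - \<Psi> (Complex x (- pi))) \<longlongrightarrow> 2 * \<i> * pi * rGamma a) at_top"
proof -
  have "((\<lambda>x. \<Psi> (Complex x pi) - \<Psi> (Complex x (- pi))) \<longlongrightarrow> 2 * \<i> * pi * rGamma a) at_top"
    if "Re a < 1 + real n" "\<And>s. (\<Psi> has_field_derivative hankel_kernel a s) (at s)" for n \<Psi>
    using that
  proof (induction n arbitrary: a \<Psi>)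
    case 0
    then show ?case by (intro hankel_limit_Re_less_1) auto
  next
    case (Suc n)
    show ?case
    proof (cases "a = 1")
      case True
      then show ?thesis using hankel_limit_1 Suc.prems by simp
    next
      case False
      have "((\<lambda>x. \<Phi> (Complex x pi) - \<Phi> (Complex x (- pi))) \<longlongrightarrow> 2 * \<i> * pi * rGamma (a - 1)) at_top"
        if "\<And>s. (\<Phi> has_field_derivative hankel_kernel (a - 1) s) (at s)" for \<Phi>
        using Suc.prems(1) that by (intro Suc.IH) auto
      from hankel_limit_plus_1[OF this, of \<Psi>] show ?thesis using False Suc.prems(2) by simp
    qed
  qed
  \<comment> \<open>Every \<open>a\<close> lies in one of the half planes reached by finitely many steps of the recurrence.\<close>
  moreover obtain n where "Re a - 1 < real n" using reals_Archimedean2 by blast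
  ultimately show ?thesis using assms by (simp add: algebra_simps)
qed

text \<open>Hankel's formula $\frac{1}{2\pi i}\int e^u u^{-a}\,du = 1/\Gamma(a)$ for every complex \<open>a\<close>,
  expressed through a primitive. The contour comes from infinity in the direction \<open>-b'\<close> and returns
  to infinity in the direction \<open>b\<close>.\<close>

lemma hankel_limit:
  assumes prim: "\<And>s. (\<Psi> has_field_derivative hankel_kernel a s) (at s)"
    and b: "pi / 2 < b" "b < 3 * pi / 2" and b': "pi / 2 < b'" "b' < 3 * pi / 2"
  shows "((\<lambda>x. \<Psi> (Complex x b) - \<Psi> (Complex x (- b'))) \<longlongrightarrow> 2 * \<i> * pi * rGamma a) at_top"
proof -
  note neg = cos_neg_between_pi_half
  have "((\<lambda>x. \<Psi> (Complex x b) - \<Psi> (Complex x pi)) \<longlongrightarrow> 0) at_top"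
    using b by (intro hankel_primitive_shift[OF prim] neg) (auto simp: closed_segment_eq_real_ivl split: if_splits)
  moreover have "((\<lambda>x. \<Psi> (Complex x (- pi)) - \<Psi> (Complex x (- b'))) \<longlongrightarrow> 0) at_top"
  proof (rule hankel_primitive_shift[OF prim])
    fix \<tau> assume "\<tau> \<in> closed_segment (- pi) (- b')"
    then show "cos \<tau> < 0"
      using b' neg[of "- \<tau>"] by (auto simp: closed_segment_eq_real_ivl split: if_splits)
  qed
  ultimately have "((\<lambda>x. (\<Psi> (Complex x b) - \<Psi> (Complex x pi)) + (\<Psi> (Complex x pi) - \<Psi> (Complex x (- pi)))
      + (\<Psi> (Complex x (- pi)) - \<Psi> (Complex x (- b')))) \<longlongrightarrow> 0 + 2 * \<i> * pi * rGamma a + 0) at_top"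
    by (intro tendsto_add hankel_limit_pi[OF prim])
  then show ?thesis by simp
qed

section \<open>The integrands in complex form\<close>
text \<open>The value of $\rho \log(z \zeta)$ for \<open>z = t * cis \<theta>\<close> and \<open>\<zeta> = r * cis \<phi>\<close>, on the branch
  with argument \<open>\<theta> + \<phi>\<close>. Its exponential is $u = (z\zeta)^\rho$.\<close>

definition ml_log :: "real \<Rightarrow> real \<Rightarrow> real \<Rightarrow> real \<Rightarrow> real \<Rightarrow> complex"
  where "ml_log \<rho> t \<theta> r \<phi> = Complex (\<rho> * ln (t * r)) (\<rho> * (\<theta> + \<phi>))"

lemma exp_ml_log_div:
  assumes "\<rho> > 0" "t > 0" "r > 0"
  shows "exp (ml_log \<rho> t \<theta> r \<phi> / of_real \<rho>) = (of_real t * cis \<theta>) * (of_real r * cis \<phi>)"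
proof -
  have "ml_log \<rho> t \<theta> r \<phi> / of_real \<rho> = Complex (ln (t * r)) (\<theta> + \<phi>)"
    using assms by (simp add: ml_log_def complex_eq_iff)
  then show ?thesis using assms by (simp add: exp_eq_polar cis_mult[symmetric])
qed

text \<open>Raising the parameter of the Hankel kernel by \<open>k / \<rho>\<close> multiplies it by $u^{-k/\rho} = (z\zeta)^{-k}$.\<close>

lemma hankel_kernel_shift:
  assumes "\<rho> > 0" "t > 0" "r > 0"
  shows "(of_real t * cis \<theta>) ^ k * hankel_kernel (\<mu> + of_real (real k / \<rho>)) (ml_log \<rho> t \<theta> r \<phi>)
    = hankel_kernel \<mu> (ml_log \<rho> t \<theta> r \<phi>) / (of_real r * cis \<phi>) ^ k"
proof -
  define s where "s = ml_log \<rho> t \<theta> r \<phi>"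
  define z \<zeta> where "z = of_real t * cis \<theta>" and "\<zeta> = of_real r * cis \<phi>"
  have nz: "z \<noteq> 0" "\<zeta> \<noteq> 0" using assms by (auto simp: z_def \<zeta>_def)
  have "exp s + (1 - (\<mu> + of_real (real k / \<rho>))) * s = exp s + (1 - \<mu>) * s - of_nat k * (s / of_real \<rho>)"
    using assms by (simp add: field_simps)
  then have "hankel_kernel (\<mu> + of_real (real k / \<rho>)) s = hankel_kernel \<mu> s / exp (s / of_real \<rho>) ^ k"
    unfolding hankel_kernel_def by (simp only: exp_diff exp_of_nat_mult)
  also have "exp (s / of_real \<rho>) = z * \<zeta>"
    unfolding s_def z_def \<zeta>_def by (rule exp_ml_log_div[OF assms])
  finally show ?thesis
    using nz unfolding s_def[symmetric] z_def[symmetric] \<zeta>_def[symmetric]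
    by (simp add: power_mult_distrib)
qed

lemma hankel_kernel_polar:
  assumes "t > 0" "r > 0"
  shows "hankel_kernel \<mu> (ml_log \<rho> t \<theta> r \<phi>) =
    of_real ((t * r) powr (\<rho> * (1 - Re \<mu>)) * ml_f \<rho> \<mu> r \<phi> t \<theta>) * cis (ml_xi \<rho> \<mu> r \<phi> t \<theta>)"
proof -
  define x y where "x = \<rho> * ln (t * r)" and "y = \<rho> * (\<theta> + \<phi>)"
  have e: "exp x = (t * r) powr \<rho>" using assms by (simp add: x_def powr_def)
  define Z where "Z = exp (Complex x y) + (1 - \<mu>) * Complex x y"
  have "Re Z = ((t * r) powr \<rho> * cos y + \<rho> * Im \<mu> * (\<theta> + \<phi>)) + \<rho> * (1 - Re \<mu>) * ln (t * r)"
    by (simp add: Z_def Re_exp e) (simp add: x_def y_def algebra_simps)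
  moreover have "\<dots> = (\<rho> * (1 - Re \<mu>) * ln (t * r)) + ((t * r) powr \<rho> * cos y + \<rho> * Im \<mu> * (\<theta> + \<phi>))"
    by simp
  ultimately have "exp (Re Z) = (t * r) powr (\<rho> * (1 - Re \<mu>)) * ml_f \<rho> \<mu> r \<phi> t \<theta>"
    using assms by (simp only: exp_add[of "\<rho> * (1 - Re \<mu>) * ln (t * r)"] ml_f_def y_def) (simp add: powr_def)
  moreover have "Im Z = (t * r) powr \<rho> * sin y + \<rho> * (1 - Re \<mu>) * (\<theta> + \<phi>) - \<rho> * Im \<mu> * ln (t * r)"
    by (simp add: Z_def Im_exp e) (simp add: x_def y_def algebra_simps)
  then have "Im Z = ml_xi \<rho> \<mu> r \<phi> t \<theta>" by (simp add: y_def ml_xi_def)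
  moreover have "hankel_kernel \<mu> (ml_log \<rho> t \<theta> r \<phi>) = exp Z"
    by (simp add: hankel_kernel_def ml_log_def Z_def x_def y_def)
  ultimately show ?thesis
    unfolding exp_eq_polar[of Z] by simp
qed

lemma cis_div_cis_minus_1:
  assumes "r > 1"
  shows "cis \<phi> / (of_real r * cis \<phi> - 1) =
    (of_real r - cis \<phi>) / of_real (r\<^sup>2 - 2 * r * cos \<phi> + 1)"
proof -
  have n: "of_real r * cis \<phi> \<noteq> 1"
  proof
    assume "of_real r * cis \<phi> = 1"
    then have "cmod (of_real r * cis \<phi>) = 1" by simp
    then show False using assms by (simp add: norm_mult)
  qed
  have "r\<^sup>2 - 2 * r * cos \<phi> + 1 \<ge> (r - 1)\<^sup>2"
    using assms by (simp add: power2_eq_square algebra_simps)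
  moreover have "(r - 1)\<^sup>2 > 0" using assms by simp
  ultimately have d: "r\<^sup>2 - 2 * r * cos \<phi> + 1 \<noteq> 0" by linarith
  have "cos \<phi> * (r\<^sup>2 - 2 * r * cos \<phi> + 1) = (r - cos \<phi>) * (r * cos \<phi> - 1) + r * (sin \<phi>)\<^sup>2"
    unfolding sin_squared_eq by (simp add: algebra_simps power2_eq_square)
  then have "cis \<phi> * of_real (r\<^sup>2 - 2 * r * cos \<phi> + 1) = (of_real r - cis \<phi>) * (of_real r * cis \<phi> - 1)"
    by (simp add: complex_eq_iff algebra_simps power2_eq_square)
  then show ?thesis
    using n d by (subst frac_eq_eq) (simp_all del: of_real_add of_real_diff)
qed

text \<open>The ray kernel is the Cauchy-type integrand $\frac{\rho}{2\pi i} e^u u^{1-\mu}/(\zeta-1)\,d\zeta$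
  on the outgoing ray minus the same on the incoming ray, and the arc kernel below is that
  integrand on the arc, where $d\zeta = i\zeta\,d\varphi$.\<close>

lemma Complex_K_eq:
  assumes "t > 0" "r > 1"
  shows "Complex (K_Re \<rho> \<mu> r \<delta> t \<theta>) (K_Im \<rho> \<mu> r \<delta> t \<theta>) = of_real \<rho> / (2 * of_real pi * \<i>) *
    (hankel_kernel \<mu> (ml_log \<rho> t \<theta> r (\<delta> - pi)) * cis (\<delta> - pi) / (of_real r * cis (\<delta> - pi) - 1)
     - hankel_kernel \<mu> (ml_log \<rho> t \<theta> r (- \<delta> - pi)) * cis (- \<delta> - pi) / (of_real r * cis (- \<delta> - pi) - 1))"
proof -
  define A where "A = (t * r) powr (\<rho> * (1 - Re \<mu>))"
  define d where "d = r\<^sup>2 + 2 * r * cos \<delta> + 1"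
  have 1: "hankel_kernel \<mu> (ml_log \<rho> t \<theta> r (\<delta>' - pi)) * cis (\<delta>' - pi) / (of_real r * cis (\<delta>' - pi) - 1)
     = of_real (A / d * ml_f \<rho> \<mu> r (\<delta>' - pi) t \<theta>) * 
       (of_real r * cis (ml_xi \<rho> \<mu> r (\<delta>' - pi) t \<theta>) + cis (ml_xi \<rho> \<mu> r (\<delta>' - pi) t \<theta> + \<delta>'))"
    if "cos \<delta>' = cos \<delta>" for \<delta>'
  proof -
    have c: "cis (\<delta>' - pi) = - cis \<delta>'" "cos (\<delta>' - pi) = - cos \<delta>" 
      using that by (simp_all add: complex_eq_iff)
    have "cis (\<delta>' - pi) / (of_real r * cis (\<delta>' - pi) - 1) = (of_real r + cis \<delta>') / of_real d"
      using cis_div_cis_minus_1[OF assms(2), of "\<delta>' - pi"] unfolding d_def c by simp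
    moreover have "hankel_kernel \<mu> (ml_log \<rho> t \<theta> r (\<delta>' - pi)) =
        of_real (A * ml_f \<rho> \<mu> r (\<delta>' - pi) t \<theta>) * cis (ml_xi \<rho> \<mu> r (\<delta>' - pi) t \<theta>)"
      using hankel_kernel_polar assms unfolding A_def by simp
    ultimately show ?thesis
      unfolding times_divide_eq_right[symmetric] cis_mult[symmetric]
      by (simp only: divide_inverse of_real_mult of_real_inverse algebra_simps)
  qed
  have 2: "of_real \<rho> / (2 * of_real pi * \<i>) = of_real (\<rho> / (2 * pi)) * - \<i>"
    by (simp add: field_simps)
  have 3: "Complex (c * k * (f * (r * sin x + sin (x + \<delta>)) - f' * (r * sin x' + sin (x' - \<delta>))))
      (c * k * (f' * (r * cos x' + cos (x' - \<delta>)) - f * (r * cos x + cos (x + \<delta>)))) =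
      of_real c * - \<i> * (of_real (k * f) * (of_real r * cis x + cis (x + \<delta>))
        - of_real (k * f') * (of_real r * cis x' + cis (x' + - \<delta>)))" for c k f f' x x' :: real
    by (simp add: complex_eq_iff algebra_simps)
  show ?thesis
    unfolding 1[of \<delta>, OF refl] 1[of "- \<delta>", OF cos_minus] 2
    unfolding K_Re_def K_Im_def A_def[symmetric] d_def[symmetric] by (rule 3)
qed

lemma Complex_P_eq:
  assumes "t > 0" "r > 1"
  shows "Complex (P_Re \<rho> \<mu> r \<phi> t \<theta>) (P_Im \<rho> \<mu> r \<phi> t \<theta>) = of_real \<rho> / (2 * of_real pi) *
    (hankel_kernel \<mu> (ml_log \<rho> t \<theta> r \<phi>) * (of_real r * cis \<phi>) / (of_real r * cis \<phi> - 1))"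
proof -
  define A where "A = (t * r) powr (\<rho> * (1 - Re \<mu>))"
  define d where "d = r\<^sup>2 - 2 * r * cos \<phi> + 1"
  have h: "hankel_kernel \<mu> (ml_log \<rho> t \<theta> r \<phi>) =
      of_real (A * ml_f \<rho> \<mu> r \<phi> t \<theta>) * cis (ml_xi \<rho> \<mu> r \<phi> t \<theta>)"
    using hankel_kernel_polar assms unfolding A_def by simp
  have "hankel_kernel \<mu> (ml_log \<rho> t \<theta> r \<phi>) * (of_real r * cis \<phi>) / (of_real r * cis \<phi> - 1)
     = hankel_kernel \<mu> (ml_log \<rho> t \<theta> r \<phi>) * of_real r * (cis \<phi> / (of_real r * cis \<phi> - 1))" by simp
  also have "\<dots> = of_real (A / d * r * ml_f \<rho> \<mu> r \<phi> t \<theta>) * 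
       (of_real r * cis (ml_xi \<rho> \<mu> r \<phi> t \<theta>) - cis (ml_xi \<rho> \<mu> r \<phi> t \<theta> + \<phi>))"
    unfolding cis_div_cis_minus_1[OF assms(2)] d_def[symmetric] cis_mult[symmetric] h
    by (simp only: divide_inverse of_real_mult of_real_inverse algebra_simps)
  finally have 1: "hankel_kernel \<mu> (ml_log \<rho> t \<theta> r \<phi>) * (of_real r * cis \<phi>) / (of_real r * cis \<phi> - 1) = \<dots>" .
  have 2: "of_real \<rho> / (2 * of_real pi) = complex_of_real (\<rho> / (2 * pi))" by simp
  have 3: "Complex (c * (A * r * f / d) * (r * cos x - cos (x + \<phi>))) (c * (A * r * f / d) * (r * sin x - sin (x + \<phi>)))
     = of_real c * (of_real (A / d * r * f) * (of_real r * cis x - cis (x + \<phi>)))" for c f x :: real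
    by (simp add: complex_eq_iff)
  show ?thesis
    unfolding 1 2 P_Re_def P_Im_def A_def[symmetric] d_def[symmetric] by (rule 3)
qed

lemma K_prime_eq_K_pi_div:
  assumes "\<rho> > 0"
  shows "K_Re' \<rho> \<mu> r t \<theta> = K_Re \<rho> \<mu> r (pi / \<rho>) t \<theta>"
    and "K_Im' \<rho> \<mu> r t \<theta> = K_Im \<rho> \<mu> r (pi / \<rho>) t \<theta>"
proof -
  have a: "\<rho> * (\<theta> + (pi / \<rho> - pi)) = \<rho> * (\<theta> - pi) + pi"
    "\<rho> * (\<theta> + (- (pi / \<rho>) - pi)) = \<rho> * (\<theta> - pi) - pi"
    using assms by (simp_all add: field_simps)
  have trig: "cos (u + pi) = - cos u" "cos (u - pi) = - cos u" "sin (u + pi) = - sin u" "sin (u - pi) = - sin u"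
    for u :: real by simp_all
  have f: "ml_f \<rho> \<mu> r (pi / \<rho> - pi) t \<theta> = exp (ml_varrho \<rho> \<mu> r t \<theta>) * exp (Im \<mu> * pi)"
    "ml_f \<rho> \<mu> r (- (pi / \<rho>) - pi) t \<theta> = exp (ml_varrho \<rho> \<mu> r t \<theta>) * exp (- Im \<mu> * pi)"
  proof -
    have *: "\<rho> * Im \<mu> * x = Im \<mu> * (\<rho> * x)" for x by simp
    show "ml_f \<rho> \<mu> r (pi / \<rho> - pi) t \<theta> = exp (ml_varrho \<rho> \<mu> r t \<theta>) * exp (Im \<mu> * pi)"
      "ml_f \<rho> \<mu> r (- (pi / \<rho>) - pi) t \<theta> = exp (ml_varrho \<rho> \<mu> r t \<theta>) * exp (- Im \<mu> * pi)"
      unfolding ml_f_def ml_varrho_def * a trig exp_add[symmetric] by (simp_all add: algebra_simps)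
  qed
  have x: "ml_xi \<rho> \<mu> r (pi / \<rho> - pi) t \<theta> = ml_xi' \<rho> \<mu> r t \<theta> + (1 - Re \<mu>) * pi"
    "ml_xi \<rho> \<mu> r (- (pi / \<rho>) - pi) t \<theta> = ml_xi' \<rho> \<mu> r t \<theta> - (1 - Re \<mu>) * pi"
  proof -
    have *: "\<rho> * (1 - Re \<mu>) * x = (1 - Re \<mu>) * (\<rho> * x)" for x by simp
    show "ml_xi \<rho> \<mu> r (pi / \<rho> - pi) t \<theta> = ml_xi' \<rho> \<mu> r t \<theta> + (1 - Re \<mu>) * pi"
      "ml_xi \<rho> \<mu> r (- (pi / \<rho>) - pi) t \<theta> = ml_xi' \<rho> \<mu> r t \<theta> - (1 - Re \<mu>) * pi"
      unfolding ml_xi_def ml_xi'_def * a trig by (simp_all add: algebra_simps)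
  qed
  show "K_Re' \<rho> \<mu> r t \<theta> = K_Re \<rho> \<mu> r (pi / \<rho>) t \<theta>" "K_Im' \<rho> \<mu> r t \<theta> = K_Im \<rho> \<mu> r (pi / \<rho>) t \<theta>"
    unfolding K_Re'_def K_Re_def K_Im'_def K_Im_def f x
    by (simp_all add: right_diff_distrib mult_ac)
qed

section \<open>Expansion of the Cauchy kernel\<close>

lemma sums_inverse_power_Suc:
  fixes \<zeta> :: "'a::real_normed_field"
  assumes "norm \<zeta> > 1"
  shows "(\<lambda>k. 1 / \<zeta> ^ Suc k) sums (1 / (\<zeta> - 1))"
proof -
  have "norm (1 / \<zeta>) < 1" using assms by (simp add: norm_divide divide_less_eq)
  from sums_mult[OF geometric_sums[OF this], of "1 / \<zeta>"]
  have "(\<lambda>k. 1 / \<zeta> ^ Suc k) sums (1 / \<zeta> * (1 / (1 - 1 / \<zeta>)))"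
    by (simp add: power_divide)
  also have "1 / \<zeta> * (1 / (1 - 1 / \<zeta>)) = 1 / (\<zeta> - 1)"
  proof -
    have "\<zeta> \<noteq> 0" "\<zeta> \<noteq> 1" using assms by auto
    then show ?thesis by (simp add: field_simps)
  qed
  finally show ?thesis .
qed

lemma norm_sum_inverse_power_Suc_le:
  fixes \<zeta> :: complex
  assumes "cmod \<zeta> \<ge> r" "r > 1"
  shows "cmod (\<Sum>k<n. 1 / \<zeta> ^ Suc k) \<le> 1 / (r - 1)"
proof -
  have le: "cmod (\<Sum>k<n. 1 / \<zeta> ^ Suc k) \<le> (\<Sum>k<n. 1 / r ^ Suc k)"
  proof (rule sum_norm_le)
    fix k
    have "r ^ Suc k \<le> cmod \<zeta> ^ Suc k" using assms by (intro power_mono) auto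
    then show "cmod (1 / \<zeta> ^ Suc k) \<le> 1 / r ^ Suc k"
      using assms by (simp add: norm_divide norm_power norm_mult frac_le)
  qed
  have s: "(\<lambda>k. 1 / r ^ Suc k) sums (1 / (r - 1))"
    using assms(2) by (intro sums_inverse_power_Suc) simp
  note le
  also have "(\<Sum>k<n. 1 / r ^ Suc k) \<le> 1 / (r - 1)"
    unfolding sums_unique[OF s] using assms
    by (intro sum_le_suminf sums_summable[OF s]) auto
  finally show ?thesis .
qed

text \<open>Termwise integration of $1/(\zeta-1) = \sum_k \zeta^{-k-1}$ outside a circle of radius greater
  than one: the partial sums are dominated by $1/(r-1)$.\<close>

lemma integral_cauchy_kernel_sums:
  fixes g \<zeta> :: "real \<Rightarrow> complex"
  assumes int: "\<And>k. (\<lambda>x. g x / \<zeta> x ^ Suc k) integrable_on S"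
    and abs: "(\<lambda>x. cmod (g x)) integrable_on S"
    and \<zeta>: "\<And>x. x \<in> S \<Longrightarrow> cmod (\<zeta> x) \<ge> r" "r > 1"
  shows "(\<lambda>x. g x / (\<zeta> x - 1)) integrable_on S"
    and "(\<lambda>k. integral S (\<lambda>x. g x / \<zeta> x ^ Suc k)) sums integral S (\<lambda>x. g x / (\<zeta> x - 1))"
proof -
  define f where "f n x = (\<Sum>k<n. g x / \<zeta> x ^ Suc k)" for n x
  have f_eq: "f n x = g x * (\<Sum>k<n. 1 / \<zeta> x ^ Suc k)" for n x
    by (simp add: f_def sum_distrib_left)
  have fi: "f n integrable_on S" for n
    unfolding f_def by (intro integrable_sum int) auto
  have hi: "(\<lambda>x. cmod (g x) * (1 / (r - 1))) integrable_on S"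
    by (intro integrable_on_mult_left abs)
  have le: "cmod (f n x) \<le> cmod (g x) * (1 / (r - 1))" if "x \<in> S" for n x
    unfolding f_eq norm_mult
    by (intro mult_left_mono norm_sum_inverse_power_Suc_le \<zeta> that) auto
  have lim: "(\<lambda>n. f n x) \<longlonglongrightarrow> g x / (\<zeta> x - 1)" if "x \<in> S" for x
  proof -
    have "cmod (\<zeta> x) > 1" using \<zeta> that by fastforce
    from tendsto_mult_left[OF sums_inverse_power_Suc[OF this, unfolded sums_def], of "g x"]
    show ?thesis by (simp add: f_eq)
  qed
  have sum: "integral S (f n) = (\<Sum>k<n. integral S (\<lambda>x. g x / \<zeta> x ^ Suc k))" for n
    unfolding f_def by (intro integral_sum int) auto
  from dominated_convergence[OF fi hi le lim]
  show "(\<lambda>x. g x / (\<zeta> x - 1)) integrable_on S"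
    and "(\<lambda>k. integral S (\<lambda>x. g x / \<zeta> x ^ Suc k)) sums integral S (\<lambda>x. g x / (\<zeta> x - 1))"
    unfolding sums_def by (simp_all add: sum del: power_Suc)
qed

section \<open>Integration along the contour\<close>
lemma continuous_on_hankel_kernel_ml_log:
  assumes "t > 0" "continuous_on S f" "continuous_on S g" "\<And>x. x \<in> S \<Longrightarrow> f x > 0"
  shows "continuous_on S (\<lambda>x. hankel_kernel \<mu> (ml_log \<rho> t \<theta> (f x) (g x)))"
proof -
  have "t * f x \<noteq> 0" if "x \<in> S" for x using assms(1) assms(4)[OF that] by simp
  then show ?thesis
    unfolding hankel_kernel_def ml_log_def Complex_eq by (intro continuous_intros assms) auto
qed

text \<open>Along a ray in the sector of decay the integrand is eventually below $r^{-2}$.\<close>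

lemma hankel_kernel_ray_absolutely_integrable:
  assumes "\<rho> > 0" "t > 0" "r\<^sub>0 > 0" and neg: "cos (\<rho> * (\<theta> + \<phi>)) < 0"
  shows "(\<lambda>r. hankel_kernel \<mu> (ml_log \<rho> t \<theta> r \<phi>)) absolutely_integrable_on {r\<^sub>0..}"
proof -
  define Q where "Q r = hankel_kernel \<mu> (ml_log \<rho> t \<theta> r \<phi>)" for r
  \<comment> \<open>With \<open>x = \<rho> * ln (t * r)\<close>, the factor \<open>r\<^sup>2 = exp (2 * x / \<rho> - 2 * ln t)\<close> is absorbed in \<open>B\<close> and \<open>C\<close>.\<close>
  define \<kappa> B C where "\<kappa> = - cos (\<rho> * (\<theta> + \<phi>))" and "B = 1 - Re \<mu> + 2 / \<rho>"
    and "C = Im \<mu> * (\<rho> * (\<theta> + \<phi>)) - 2 * ln t"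
  have lim: "((\<lambda>r. exp (- \<kappa> * exp (\<rho> * ln (t * r)) + B * (\<rho> * ln (t * r)) + C)) \<longlongrightarrow> 0) at_top"
  proof (rule filterlim_compose[OF exp_minus_exp_tendsto_0])
    show "\<kappa> > 0" using neg by (simp add: \<kappa>_def)
    show "filterlim (\<lambda>r. \<rho> * ln (t * r)) at_top at_top"
      using assms(1,2) by real_asymp
  qed
  have eq: "exp (- \<kappa> * exp (\<rho> * ln (t * r)) + B * (\<rho> * ln (t * r)) + C) = cmod (Q r) * r ^ 2" if "r > 0" for r
  proof -
    define x where "x = \<rho> * ln (t * r)"
    have "x / \<rho> = ln t + ln r" using that assms by (simp add: x_def ln_mult)
    moreover have "B * x = (1 - Re \<mu>) * x + 2 * (x / \<rho>)" by (simp add: B_def algebra_simps)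
    ultimately have "B * x + C = (1 - Re \<mu>) * x + Im \<mu> * (\<rho> * (\<theta> + \<phi>)) + 2 * ln r"
      by (simp add: C_def)
    then have "- \<kappa> * exp x + B * x + C = 
        (exp x * cos (\<rho> * (\<theta> + \<phi>)) + (1 - Re \<mu>) * x + Im \<mu> * (\<rho> * (\<theta> + \<phi>))) + (ln r + ln r)"
      by (simp add: \<kappa>_def algebra_simps)
    moreover have "exp (ln r + ln r) = r ^ 2"
      using that by (simp only: exp_add exp_ln power2_eq_square)
    ultimately show ?thesis
      unfolding Q_def ml_log_def norm_hankel_kernel x_def[symmetric]
      by (simp only: exp_add[of _ "ln r + ln r"])
  qed
  from order_tendstoD(2)[OF lim zero_less_one] have "\<forall>\<^sub>F r in at_top. cmod (Q r) \<le> r powr (-2) \<and> r \<ge> r\<^sub>0"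
    using eventually_ge_at_top[of r\<^sub>0]
  proof eventually_elim
    case (elim r)
    then have "r > 0" using assms(3) by simp
    then have "cmod (Q r) * r ^ 2 < 1" using elim(1) unfolding eq[OF \<open>r > 0\<close>] by blast
    then have "cmod (Q r) \<le> 1 / r ^ 2" using \<open>r > 0\<close> by (simp add: pos_le_divide_eq)
    then show ?case using elim \<open>r > 0\<close> by (simp add: powr_minus divide_inverse)
  qed
  then obtain R where R: "\<And>r. r \<ge> R \<Longrightarrow> cmod (Q r) \<le> r powr (-2) \<and> r \<ge> r\<^sub>0"
    unfolding eventually_at_top_linorder by blast
  have R0: "R \<ge> r\<^sub>0" using R by blast
  have cont: "continuous_on {r\<^sub>0..} Q"
    unfolding Q_def using assms(3) by (intro continuous_on_hankel_kernel_ml_log assms(2) continuous_intros) auto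
  have "Q absolutely_integrable_on {r\<^sub>0..R}"
    using cont continuous_on_subset by (intro absolutely_integrable_continuous_real) fastforce
  moreover have "Q absolutely_integrable_on {R..}"
  proof (rule measurable_bounded_by_integrable_imp_absolutely_integrable)
    show "Q \<in> borel_measurable (lebesgue_on {R..})"
      using cont R0 by (intro continuous_imp_measurable_on_sets_lebesgue) (auto intro: continuous_on_subset)
    show "(\<lambda>r. r powr (-2)) integrable_on {R..}"
      using has_integral_powr_to_inf[of "-2" R] R0 assms(3) by auto
  qed (use R in auto)
  ultimately have "Q absolutely_integrable_on ({r\<^sub>0..R} \<union> {R..})"
    by (rule absolutely_integrable_Un)
  also have "{r\<^sub>0..R} \<union> {R..} = {r\<^sub>0..}" using R0 by auto
  finally show ?thesis unfolding Q_def .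
qed

lemma ml_log_derivatives:
  assumes "t > 0" "r > 0"
  shows "((\<lambda>r. ml_log \<rho> t \<theta> r \<phi>) has_vector_derivative of_real (\<rho> / r)) (at r)"
    and "((\<lambda>\<phi>. ml_log \<rho> t \<theta> r \<phi>) has_vector_derivative \<i> * of_real \<rho>) (at \<phi>)"
proof -
  have "((\<lambda>r. \<rho> * ln (t * r)) has_real_derivative \<rho> / r) (at r)"
    using assms by (auto intro!: derivative_eq_intros simp: field_simps)
  from has_vector_derivative_add[OF has_vector_derivative_of_real[OF this]
      has_vector_derivative_const[of "\<i> * of_real (\<rho> * (\<theta> + \<phi>))"]]
  show "((\<lambda>r. ml_log \<rho> t \<theta> r \<phi>) has_vector_derivative of_real (\<rho> / r)) (at r)"
    unfolding ml_log_def Complex_eq by simp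
  have "((\<lambda>\<phi>. \<rho> * (\<theta> + \<phi>)) has_real_derivative \<rho>) (at \<phi>)"
    by (auto intro!: derivative_eq_intros)
  from has_vector_derivative_add[OF has_vector_derivative_const[of "of_real (\<rho> * ln (t * r))"]
      has_vector_derivative_mult_right[OF has_vector_derivative_of_real[OF this], of \<i>]]
  show "((\<lambda>\<phi>. ml_log \<rho> t \<theta> r \<phi>) has_vector_derivative \<i> * of_real \<rho>) (at \<phi>)"
    unfolding ml_log_def Complex_eq by simp
qed

lemma ray_integrand_absolutely_integrable:
  assumes abs: "(\<lambda>r. hankel_kernel \<mu> (ml_log \<rho> t \<theta> r \<phi>)) absolutely_integrable_on {r\<^sub>0..}"
    and "t > 0" "r\<^sub>0 \<ge> 1"
  shows "(\<lambda>r. hankel_kernel \<mu> (ml_log \<rho> t \<theta> r \<phi>) * cis \<phi> / (of_real r * cis \<phi>) ^ k)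
           absolutely_integrable_on {r\<^sub>0..}"
proof (rule measurable_bounded_by_integrable_imp_absolutely_integrable)
  show "(\<lambda>r. hankel_kernel \<mu> (ml_log \<rho> t \<theta> r \<phi>) * cis \<phi> / (of_real r * cis \<phi>) ^ k)
      \<in> borel_measurable (lebesgue_on {r\<^sub>0..})"
    using assms(2,3)
    by (intro continuous_imp_measurable_on_sets_lebesgue continuous_intros continuous_on_hankel_kernel_ml_log) auto
  show "(\<lambda>r. cmod (hankel_kernel \<mu> (ml_log \<rho> t \<theta> r \<phi>))) integrable_on {r\<^sub>0..}"
    using abs by (simp add: absolutely_integrable_on_def)
  show "cmod (hankel_kernel \<mu> (ml_log \<rho> t \<theta> r \<phi>) * cis \<phi> / (of_real r * cis \<phi>) ^ k)
      \<le> cmod (hankel_kernel \<mu> (ml_log \<rho> t \<theta> r \<phi>))" if "r \<in> {r\<^sub>0..}" for r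
  proof -
    have "r ^ k \<ge> 1" using that assms(3) by (intro one_le_power) auto
    moreover have "r > 0" using that assms(3) by auto
    ultimately show ?thesis
      using mult_left_mono[of 1 "r ^ k" "cmod (hankel_kernel \<mu> (ml_log \<rho> t \<theta> r \<phi>))"]
      by (simp add: norm_mult norm_divide norm_power pos_divide_le_eq)
  qed
qed simp

text \<open>One term of the Mittag-Leffler series. The rays and the arc of the \<open>\<zeta>\<close>-contour correspond to a
  Hankel contour in the coordinate \<open>u\<close>; the contributions of the primitive at the two corners
  cancel, and the limit at infinity is given by Hankel's formula.\<close>

lemma power_times_rGamma_integral:
  fixes \<mu> :: complex and \<theta> :: real
  assumes "\<rho> > 0" "t > 0" "r\<^sub>0 \<ge> 1" "\<phi>\<^sub>1 \<le> \<phi>\<^sub>2"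
    and b: "pi / 2 < \<rho> * (\<theta> + \<phi>\<^sub>2)" "\<rho> * (\<theta> + \<phi>\<^sub>2) < 3 * pi / 2"
    and b': "- (3 * pi / 2) < \<rho> * (\<theta> + \<phi>\<^sub>1)" "\<rho> * (\<theta> + \<phi>\<^sub>1) < - (pi / 2)"
    and abs\<^sub>1: "(\<lambda>r. hankel_kernel \<mu> (ml_log \<rho> t \<theta> r \<phi>\<^sub>1)) absolutely_integrable_on {r\<^sub>0..}"
    and abs\<^sub>2: "(\<lambda>r. hankel_kernel \<mu> (ml_log \<rho> t \<theta> r \<phi>\<^sub>2)) absolutely_integrable_on {r\<^sub>0..}"
  defines "I \<equiv> \<lambda>k \<phi>. integral {r\<^sub>0..} (\<lambda>r. hankel_kernel \<mu> (ml_log \<rho> t \<theta> r \<phi>) * cis \<phi> / (of_real r * cis \<phi>) ^ Suc k)"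
  defines "J \<equiv> \<lambda>k. integral {\<phi>\<^sub>1..\<phi>\<^sub>2} (\<lambda>\<phi>. hankel_kernel \<mu> (ml_log \<rho> t \<theta> r\<^sub>0 \<phi>) * (of_real r\<^sub>0 * cis \<phi>) / (of_real r\<^sub>0 * cis \<phi>) ^ Suc k)"
  shows "(of_real t * cis \<theta>) ^ k * rGamma (\<mu> + of_real (real k / \<rho>)) =
    of_real \<rho> / (2 * of_real pi * \<i>) * (I k \<phi>\<^sub>2 - I k \<phi>\<^sub>1) + of_real \<rho> / (2 * of_real pi) * J k"
proof -
  define a where "a = \<mu> + of_real (real k / \<rho>)"
  obtain \<Psi> where prim: "\<And>s. (\<Psi> has_field_derivative hankel_kernel a s) (at s)"
    using hankel_kernel_primitive by blast
  define c where "c = (of_real t * cis \<theta>) ^ k / of_real \<rho>"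
  define \<Phi> where "\<Phi> r \<phi> = c * \<Psi> (ml_log \<rho> t \<theta> r \<phi>)" for r \<phi>
  define q where "q r \<phi> = hankel_kernel \<mu> (ml_log \<rho> t \<theta> r \<phi>)" for r \<phi>
  have shift: "c * hankel_kernel a (ml_log \<rho> t \<theta> r \<phi>) = q r \<phi> / (of_real r * cis \<phi>) ^ k / of_real \<rho>"
    if "r > 0" for r \<phi>
    using hankel_kernel_shift[OF assms(1,2) that, of \<theta> k \<mu> \<phi>] by (simp add: c_def a_def q_def)
  have d\<Psi>: "((\<lambda>x. c * \<Psi> (f x)) has_vector_derivative c * (hankel_kernel a (f x) * f')) (at x)"
    if "(f has_vector_derivative f') (at x)" for f f' and x :: real
    using has_vector_derivative_mult_right[OF field_vector_diff_chain_at[OF that prim], of c]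
    by (simp add: o_def mult.commute)
  have dr: "((\<lambda>r. \<Phi> r \<phi>) has_vector_derivative q r \<phi> * cis \<phi> / (of_real r * cis \<phi>) ^ Suc k) (at r)"
    if "r > 0" for r \<phi>
  proof -
    have "c * (hankel_kernel a (ml_log \<rho> t \<theta> r \<phi>) * of_real (\<rho> / r)) = q r \<phi> * cis \<phi> / (of_real r * cis \<phi>) ^ Suc k"
      using that assms(1) by (simp add: shift flip: mult.assoc)
    then show ?thesis
      using d\<Psi>[OF ml_log_derivatives(1)[OF assms(2) that, of \<rho> \<theta> \<phi>]] by (simp add: \<Phi>_def)
  qed
  have d\<phi>: "((\<lambda>\<phi>. \<Phi> r\<^sub>0 \<phi>) has_vector_derivative
      \<i> * (q r\<^sub>0 \<phi> * (of_real r\<^sub>0 * cis \<phi>) / (of_real r\<^sub>0 * cis \<phi>) ^ Suc k)) (at \<phi>)" for \<phi>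
  proof -
    have r0: "r\<^sub>0 > 0" using assms(3) by simp
    have e: "c * (hankel_kernel a (ml_log \<rho> t \<theta> r\<^sub>0 \<phi>) * (\<i> * of_real \<rho>)) =
        \<i> * (q r\<^sub>0 \<phi> * (of_real r\<^sub>0 * cis \<phi>) / (of_real r\<^sub>0 * cis \<phi>) ^ Suc k)"
      using r0 assms(1) by (simp add: shift flip: mult.assoc)
    show ?thesis
      using d\<Psi>[OF ml_log_derivatives(2)[OF assms(2) r0, of \<rho> \<theta> \<phi>]] unfolding e \<Phi>_def .
  qed
  have abs: "(\<lambda>r. hankel_kernel \<mu> (ml_log \<rho> t \<theta> r \<phi>)) absolutely_integrable_on {r\<^sub>0..}"
    if "\<phi> \<in> {\<phi>\<^sub>1, \<phi>\<^sub>2}" for \<phi>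
    using that abs\<^sub>1 abs\<^sub>2 by auto
  have ray: "((\<lambda>R. \<Phi> R \<phi> - \<Phi> r\<^sub>0 \<phi>) \<longlongrightarrow> I k \<phi>) at_top" if "\<phi> \<in> {\<phi>\<^sub>1, \<phi>\<^sub>2}" for \<phi>
  proof (rule Lim_transform_eventually)
    show "((\<lambda>R. integral {r\<^sub>0..R} (\<lambda>r. q r \<phi> * cis \<phi> / (of_real r * cis \<phi>) ^ Suc k)) \<longlongrightarrow> I k \<phi>) at_top"
      unfolding I_def q_def by (intro integral_to_inf_tendsto ray_integrand_absolutely_integrable abs that assms)
    show "\<forall>\<^sub>F R in at_top. integral {r\<^sub>0..R} (\<lambda>r. q r \<phi> * cis \<phi> / (of_real r * cis \<phi>) ^ Suc k) = \<Phi> R \<phi> - \<Phi> r\<^sub>0 \<phi>"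
      using eventually_ge_at_top[of r\<^sub>0]
    proof eventually_elim
      case (elim R)
      then show ?case using assms(3)
        by (intro integral_unique fundamental_theorem_of_calculus dr[THEN has_vector_derivative_at_within]) auto
    qed
  qed
  have arc: "\<i> * J k = \<Phi> r\<^sub>0 \<phi>\<^sub>2 - \<Phi> r\<^sub>0 \<phi>\<^sub>1"
  proof -
    have "((\<lambda>\<phi>. \<i> * (q r\<^sub>0 \<phi> * (of_real r\<^sub>0 * cis \<phi>) / (of_real r\<^sub>0 * cis \<phi>) ^ Suc k)) has_integral
        \<Phi> r\<^sub>0 \<phi>\<^sub>2 - \<Phi> r\<^sub>0 \<phi>\<^sub>1) {\<phi>\<^sub>1..\<phi>\<^sub>2}"
      by (intro fundamental_theorem_of_calculus d\<phi>[THEN has_vector_derivative_at_within] assms(4))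
    from integral_unique[OF this] show ?thesis
      unfolding J_def q_def integral_mult_right .
  qed
  \<comment> \<open>The values of the primitive on the circle of radius \<open>r\<^sub>0\<close> cancel.\<close>
  have "((\<lambda>R. (\<Phi> R \<phi>\<^sub>2 - \<Phi> r\<^sub>0 \<phi>\<^sub>2) - (\<Phi> R \<phi>\<^sub>1 - \<Phi> r\<^sub>0 \<phi>\<^sub>1) + \<i> * J k) \<longlongrightarrow> I k \<phi>\<^sub>2 - I k \<phi>\<^sub>1 + \<i> * J k) at_top"
    by (intro tendsto_intros ray) auto
  then have l1: "((\<lambda>R. \<Phi> R \<phi>\<^sub>2 - \<Phi> R \<phi>\<^sub>1) \<longlongrightarrow> I k \<phi>\<^sub>2 - I k \<phi>\<^sub>1 + \<i> * J k) at_top"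
    unfolding arc by (simp add: algebra_simps)
  have "((\<lambda>x. \<Psi> (Complex x (\<rho> * (\<theta> + \<phi>\<^sub>2))) - \<Psi> (Complex x (- (- (\<rho> * (\<theta> + \<phi>\<^sub>1)))))) \<longlongrightarrow> 2 * \<i> * pi * rGamma a) at_top"
    using b b' by (intro hankel_limit[OF prim]) auto
  moreover have "filterlim (\<lambda>R. \<rho> * ln (t * R)) at_top at_top"
    using assms(1,2) by real_asymp
  ultimately have "((\<lambda>R. \<Psi> (ml_log \<rho> t \<theta> R \<phi>\<^sub>2) - \<Psi> (ml_log \<rho> t \<theta> R \<phi>\<^sub>1)) \<longlongrightarrow> 2 * \<i> * pi * rGamma a) at_top"
    unfolding ml_log_def minus_minus by (rule filterlim_compose)
  from tendsto_mult_left[OF this, of c]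
  have l2: "((\<lambda>R. \<Phi> R \<phi>\<^sub>2 - \<Phi> R \<phi>\<^sub>1) \<longlongrightarrow> c * (2 * \<i> * pi * rGamma a)) at_top"
    by (simp add: \<Phi>_def algebra_simps)
  from tendsto_unique[OF _ l1 l2] have "I k \<phi>\<^sub>2 - I k \<phi>\<^sub>1 = c * (2 * \<i> * pi * rGamma a) - \<i> * J k"
    by (simp add: algebra_simps)
  then show ?thesis
    using assms(1) unfolding a_def[symmetric] by (simp add: c_def field_simps)
qed

text \<open>The contour integral representation
  $E_{\rho,\mu}(z) = \frac{\rho}{2\pi i}\int e^u u^{1-\mu}\,\frac{d\zeta}{\zeta-1}$ with
  $u = (z\zeta)^\rho$.\<close>

lemma mittag_leffler_integral:
  fixes \<mu> :: complex and \<theta> :: real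
  assumes "\<rho> > 0" "t > 0" "r\<^sub>0 > 1" "\<phi>\<^sub>1 \<le> \<phi>\<^sub>2"
    and b: "pi / 2 < \<rho> * (\<theta> + \<phi>\<^sub>2)" "\<rho> * (\<theta> + \<phi>\<^sub>2) < 3 * pi / 2"
    and b': "- (3 * pi / 2) < \<rho> * (\<theta> + \<phi>\<^sub>1)" "\<rho> * (\<theta> + \<phi>\<^sub>1) < - (pi / 2)"
  defines "H \<equiv> \<lambda>\<phi> r. hankel_kernel \<mu> (ml_log \<rho> t \<theta> r \<phi>) * cis \<phi> / (of_real r * cis \<phi> - 1)"
  defines "A \<equiv> \<lambda>\<phi>. hankel_kernel \<mu> (ml_log \<rho> t \<theta> r\<^sub>0 \<phi>) * (of_real r\<^sub>0 * cis \<phi>) / (of_real r\<^sub>0 * cis \<phi> - 1)"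
  shows "H \<phi>\<^sub>1 integrable_on {r\<^sub>0..}" "H \<phi>\<^sub>2 integrable_on {r\<^sub>0..}" "A integrable_on {\<phi>\<^sub>1..\<phi>\<^sub>2}"
    and "mittag_leffler \<rho> \<mu> (of_real t * cis \<theta>) =
      of_real \<rho> / (2 * of_real pi * \<i>) * (integral {r\<^sub>0..} (H \<phi>\<^sub>2) - integral {r\<^sub>0..} (H \<phi>\<^sub>1))
      + of_real \<rho> / (2 * of_real pi) * integral {\<phi>\<^sub>1..\<phi>\<^sub>2} A"
proof -
  have abs: "(\<lambda>r. hankel_kernel \<mu> (ml_log \<rho> t \<theta> r \<phi>)) absolutely_integrable_on {r\<^sub>0..}"
    if "\<phi> \<in> {\<phi>\<^sub>1, \<phi>\<^sub>2}" for \<phi>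
  proof (rule hankel_kernel_ray_absolutely_integrable)
    have "cos (\<rho> * (\<theta> + \<phi>\<^sub>2)) < 0"
      using b by (rule cos_neg_between_pi_half)
    moreover have "cos (- (\<rho> * (\<theta> + \<phi>\<^sub>1))) < 0"
      using b' by (intro cos_neg_between_pi_half) auto
    ultimately show "cos (\<rho> * (\<theta> + \<phi>)) < 0" using that by auto
  qed (use assms in auto)
  have r0: "cmod (of_real r * cis \<phi>) \<ge> r\<^sub>0" if "r \<ge> r\<^sub>0" for r \<phi>
    using that assms(3) by (simp add: norm_mult)
  have ray: "H \<phi> integrable_on {r\<^sub>0..}"
    "(\<lambda>k. integral {r\<^sub>0..} (\<lambda>r. hankel_kernel \<mu> (ml_log \<rho> t \<theta> r \<phi>) * cis \<phi> / (of_real r * cis \<phi>) ^ Suc k))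
       sums integral {r\<^sub>0..} (H \<phi>)" if "\<phi> \<in> {\<phi>\<^sub>1, \<phi>\<^sub>2}" for \<phi>
  proof -
    have 1: "(\<lambda>r. hankel_kernel \<mu> (ml_log \<rho> t \<theta> r \<phi>) * cis \<phi> / (of_real r * cis \<phi>) ^ Suc k) integrable_on {r\<^sub>0..}" for k
      using ray_integrand_absolutely_integrable[OF abs[OF that] assms(2), of "Suc k"] assms(3)
      by (simp only: absolutely_integrable_on_def less_imp_le simp_thms)
    have 2: "(\<lambda>r. cmod (hankel_kernel \<mu> (ml_log \<rho> t \<theta> r \<phi>) * cis \<phi>)) integrable_on {r\<^sub>0..}"
      using abs[OF that] by (simp add: absolutely_integrable_on_def norm_mult)
    show "H \<phi> integrable_on {r\<^sub>0..}"
    "(\<lambda>k. integral {r\<^sub>0..} (\<lambda>r. hankel_kernel \<mu> (ml_log \<rho> t \<theta> r \<phi>) * cis \<phi> / (of_real r * cis \<phi>) ^ Suc k))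
       sums integral {r\<^sub>0..} (H \<phi>)"
      unfolding H_def using integral_cauchy_kernel_sums[OF 1 2 r0 assms(3)] by auto
  qed
  have arc: "A integrable_on {\<phi>\<^sub>1..\<phi>\<^sub>2}"
    "(\<lambda>k. integral {\<phi>\<^sub>1..\<phi>\<^sub>2} (\<lambda>\<phi>. hankel_kernel \<mu> (ml_log \<rho> t \<theta> r\<^sub>0 \<phi>) * (of_real r\<^sub>0 * cis \<phi>) / (of_real r\<^sub>0 * cis \<phi>) ^ Suc k))
       sums integral {\<phi>\<^sub>1..\<phi>\<^sub>2} A"
  proof -
    have 1: "(\<lambda>\<phi>. hankel_kernel \<mu> (ml_log \<rho> t \<theta> r\<^sub>0 \<phi>) * (of_real r\<^sub>0 * cis \<phi>) / (of_real r\<^sub>0 * cis \<phi>) ^ Suc k)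
        integrable_on {\<phi>\<^sub>1..\<phi>\<^sub>2}" for k
      using assms(2,3) 
      by (intro integrable_continuous_real continuous_intros continuous_on_hankel_kernel_ml_log) auto
    have 2: "(\<lambda>\<phi>. cmod (hankel_kernel \<mu> (ml_log \<rho> t \<theta> r\<^sub>0 \<phi>) * (of_real r\<^sub>0 * cis \<phi>))) integrable_on {\<phi>\<^sub>1..\<phi>\<^sub>2}"
      using assms(2,3) 
      by (intro integrable_continuous_real continuous_intros continuous_on_hankel_kernel_ml_log) auto
    show "A integrable_on {\<phi>\<^sub>1..\<phi>\<^sub>2}"
    "(\<lambda>k. integral {\<phi>\<^sub>1..\<phi>\<^sub>2} (\<lambda>\<phi>. hankel_kernel \<mu> (ml_log \<rho> t \<theta> r\<^sub>0 \<phi>) * (of_real r\<^sub>0 * cis \<phi>) / (of_real r\<^sub>0 * cis \<phi>) ^ Suc k))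
       sums integral {\<phi>\<^sub>1..\<phi>\<^sub>2} A"
      unfolding A_def using integral_cauchy_kernel_sums[OF 1 2 r0 assms(3)] by auto
  qed
  show "H \<phi>\<^sub>1 integrable_on {r\<^sub>0..}" "H \<phi>\<^sub>2 integrable_on {r\<^sub>0..}" "A integrable_on {\<phi>\<^sub>1..\<phi>\<^sub>2}"
    using ray(1) arc(1) by auto
  have r1: "1 \<le> r\<^sub>0" using assms(3) by simp
  have "(\<lambda>k. (of_real t * cis \<theta>) ^ k * rGamma (\<mu> + of_real (real k / \<rho>))) sums
     (of_real \<rho> / (2 * of_real pi * \<i>) * (integral {r\<^sub>0..} (H \<phi>\<^sub>2) - integral {r\<^sub>0..} (H \<phi>\<^sub>1))
      + of_real \<rho> / (2 * of_real pi) * integral {\<phi>\<^sub>1..\<phi>\<^sub>2} A)"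
    unfolding power_times_rGamma_integral[OF assms(1,2) r1 assms(4) b b' abs[OF insertI1] abs[OF insertI2[OF singletonI]]]
    by (intro sums_add sums_mult sums_diff ray(2) arc(2)) auto
  then show "mittag_leffler \<rho> \<mu> (of_real t * cis \<theta>) =
      of_real \<rho> / (2 * of_real pi * \<i>) * (integral {r\<^sub>0..} (H \<phi>\<^sub>2) - integral {r\<^sub>0..} (H \<phi>\<^sub>1))
      + of_real \<rho> / (2 * of_real pi) * integral {\<phi>\<^sub>1..\<phi>\<^sub>2} A"
    unfolding mittag_leffler_def by (rule sums_unique[symmetric])
qed

section \<open>Separation into real and imaginary parts\<close>

lemma has_integral_Complex_parts:
  assumes "((\<lambda>x. Complex (f x) (g x)) has_integral I) S"
  shows "f integrable_on S" "g integrable_on S" "I = Complex (integral S f) (integral S g)"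
proof -
  have "(f has_integral Re I) S" "(g has_integral Im I) S"
    using has_integral_linear[OF assms bounded_linear_Re] has_integral_linear[OF assms bounded_linear_Im]
    by (simp_all add: o_def)
  then show "f integrable_on S" "g integrable_on S" "I = Complex (integral S f) (integral S g)"
    by (auto simp: integral_unique)
qed

text \<open>The real form of the representation with \<open>\<phi>\<^sub>1 = - \<delta> - pi\<close> and \<open>\<phi>\<^sub>2 = \<delta> - pi\<close>. The hypotheses on \<open>\<theta>\<close>
  put \<open>\<rho> * (\<theta> + \<phi>\<^sub>2)\<close> above \<open>pi / 2\<close> and \<open>\<rho> * (\<theta> + \<phi>\<^sub>1)\<close> below \<open>- pi / 2\<close>; as the two differ by
  \<open>2 * \<rho> * \<delta> \<le> 2 * pi\<close>, they stay within \<open>3 * pi / 2\<close> of zero.\<close>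

lemma mittag_leffler_real_integrals:
  assumes "\<rho> > 0" "\<epsilon> > 0" "t > 0"
    and "pi / (2 * \<rho>) - \<delta> + pi < \<theta>" and "\<theta> < - pi / (2 * \<rho>) + \<delta> + pi"
    and \<delta>: "\<delta> \<le> pi / \<rho>"
  shows "(\<lambda>r. K_Re \<rho> \<mu> r \<delta> t \<theta>) integrable_on {1 + \<epsilon>..} \<and>
      (\<lambda>\<phi>. P_Re \<rho> \<mu> (1 + \<epsilon>) \<phi> t \<theta>) integrable_on {- \<delta> - pi..\<delta> - pi} \<and>
      (\<lambda>r. K_Im \<rho> \<mu> r \<delta> t \<theta>) integrable_on {1 + \<epsilon>..} \<and>
      (\<lambda>\<phi>. P_Im \<rho> \<mu> (1 + \<epsilon>) \<phi> t \<theta>) integrable_on {- \<delta> - pi..\<delta> - pi} \<and>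
      mittag_leffler \<rho> \<mu> (of_real t * cis \<theta>) =
        complex_of_real
          (integral {1 + \<epsilon>..} (\<lambda>r. K_Re \<rho> \<mu> r \<delta> t \<theta>)
           + integral {- \<delta> - pi..\<delta> - pi} (\<lambda>\<phi>. P_Re \<rho> \<mu> (1 + \<epsilon>) \<phi> t \<theta>))
        + \<i> * complex_of_real
          (integral {1 + \<epsilon>..} (\<lambda>r. K_Im \<rho> \<mu> r \<delta> t \<theta>)
           + integral {- \<delta> - pi..\<delta> - pi} (\<lambda>\<phi>. P_Im \<rho> \<mu> (1 + \<epsilon>) \<phi> t \<theta>))"
proof -
  have \<epsilon>: "1 + \<epsilon> > 1" using assms(2) by simp
  have h: "\<rho> * (pi / (2 * \<rho>)) = pi / 2" using assms(1) by simp
  have \<rho>\<delta>: "\<rho> * \<delta> \<le> pi" using \<delta> assms(1) by (simp add: field_simps)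
  have "pi / (2 * \<rho>) < \<theta> + (\<delta> - pi)" using assms(4) by simp
  then have lo: "pi / 2 < \<rho> * (\<theta> + (\<delta> - pi))" 
    using mult_strict_left_mono[OF _ assms(1)] unfolding h[symmetric] by blast
  have "\<theta> + (- \<delta> - pi) < - (pi / (2 * \<rho>))" using assms(5) by simp
  from mult_strict_left_mono[OF this assms(1)]
  have up: "\<rho> * (\<theta> + (- \<delta> - pi)) < - (pi / 2)" unfolding mult_minus_right h .
  have eq: "\<rho> * (\<theta> + (\<delta> - pi)) = \<rho> * (\<theta> + (- \<delta> - pi)) + 2 * (\<rho> * \<delta>)" by (simp add: algebra_simps)
  have "0 < \<rho> * \<delta>" using eq lo up pi_gt_zero by linarith
  then have "\<delta> > 0" using assms(1) by (simp add: zero_less_mult_iff)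
  then have le: "- \<delta> - pi \<le> \<delta> - pi" by simp
  have lo': "- (3 * pi / 2) < \<rho> * (\<theta> + (- \<delta> - pi))" and up': "\<rho> * (\<theta> + (\<delta> - pi)) < 3 * pi / 2"
    using eq lo up \<rho>\<delta> by linarith+
  note main = mittag_leffler_integral[OF assms(1,3) \<epsilon> le lo up' lo' up, where \<mu> = \<mu>]
  have K: "((\<lambda>r. Complex (K_Re \<rho> \<mu> r \<delta> t \<theta>) (K_Im \<rho> \<mu> r \<delta> t \<theta>)) has_integral
     of_real \<rho> / (2 * of_real pi * \<i>) *
     (integral {1 + \<epsilon>..} (\<lambda>r. hankel_kernel \<mu> (ml_log \<rho> t \<theta> r (\<delta> - pi)) * cis (\<delta> - pi) / (of_real r * cis (\<delta> - pi) - 1))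
    - integral {1 + \<epsilon>..} (\<lambda>r. hankel_kernel \<mu> (ml_log \<rho> t \<theta> r (- \<delta> - pi)) * cis (- \<delta> - pi) / (of_real r * cis (- \<delta> - pi) - 1))))
     {1 + \<epsilon>..}"
  proof (rule has_integral_eq)
    show "of_real \<rho> / (2 * of_real pi * \<i>) *
    (hankel_kernel \<mu> (ml_log \<rho> t \<theta> r (\<delta> - pi)) * cis (\<delta> - pi) / (of_real r * cis (\<delta> - pi) - 1)
     - hankel_kernel \<mu> (ml_log \<rho> t \<theta> r (- \<delta> - pi)) * cis (- \<delta> - pi) / (of_real r * cis (- \<delta> - pi) - 1))
      = Complex (K_Re \<rho> \<mu> r \<delta> t \<theta>) (K_Im \<rho> \<mu> r \<delta> t \<theta>)" if "r \<in> {1 + \<epsilon>..}" for r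
      using that assms(2,3) by (intro Complex_K_eq[symmetric]) auto
  qed (intro has_integral_mult_right has_integral_diff integrable_integral main)
  have P: "((\<lambda>\<phi>. Complex (P_Re \<rho> \<mu> (1 + \<epsilon>) \<phi> t \<theta>) (P_Im \<rho> \<mu> (1 + \<epsilon>) \<phi> t \<theta>)) has_integral
     of_real \<rho> / (2 * of_real pi) * integral {- \<delta> - pi..\<delta> - pi}
      (\<lambda>\<phi>. hankel_kernel \<mu> (ml_log \<rho> t \<theta> (1 + \<epsilon>) \<phi>) * (of_real (1 + \<epsilon>) * cis \<phi>) / (of_real (1 + \<epsilon>) * cis \<phi> - 1)))
     {- \<delta> - pi..\<delta> - pi}"
    unfolding Complex_P_eq[OF assms(3) \<epsilon>]
    by (intro has_integral_mult_right integrable_integral main)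
  from has_integral_Complex_parts[OF K] has_integral_Complex_parts[OF P] main(4)
  show ?thesis by (simp add: complex_eq_iff)
qed

theorem corollary1:
  fixes \<rho> \<epsilon> \<delta> t \<theta> :: real and \<mu> z :: complex
  assumes "\<rho> > 1 / 2" and "\<epsilon> > 0"
    and "z = complex_of_real t * exp (\<i> * complex_of_real \<theta>)" and "t = cmod z" and "t > 0"
    and "pi / (2 * \<rho>) - \<delta> + pi < \<theta>" and "\<theta> < - pi / (2 * \<rho>) + \<delta> + pi"
  shows "(pi / (2 * \<rho>) < \<delta> \<and> \<delta> \<le> min pi (pi / \<rho>) \<longrightarrow>
      (\<lambda>r. K_Re \<rho> \<mu> r \<delta> t \<theta>) integrable_on {1 + \<epsilon>..} \<and>
      (\<lambda>\<phi>. P_Re \<rho> \<mu> (1 + \<epsilon>) \<phi> t \<theta>) integrable_on {- \<delta> - pi..\<delta> - pi} \<and>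
      (\<lambda>r. K_Im \<rho> \<mu> r \<delta> t \<theta>) integrable_on {1 + \<epsilon>..} \<and>
      (\<lambda>\<phi>. P_Im \<rho> \<mu> (1 + \<epsilon>) \<phi> t \<theta>) integrable_on {- \<delta> - pi..\<delta> - pi} \<and>
      mittag_leffler \<rho> \<mu> z =
        complex_of_real
          (integral {1 + \<epsilon>..} (\<lambda>r. K_Re \<rho> \<mu> r \<delta> t \<theta>)
           + integral {- \<delta> - pi..\<delta> - pi} (\<lambda>\<phi>. P_Re \<rho> \<mu> (1 + \<epsilon>) \<phi> t \<theta>))
        + \<i> * complex_of_real
          (integral {1 + \<epsilon>..} (\<lambda>r. K_Im \<rho> \<mu> r \<delta> t \<theta>)
           + integral {- \<delta> - pi..\<delta> - pi} (\<lambda>\<phi>. P_Im \<rho> \<mu> (1 + \<epsilon>) \<phi> t \<theta>)))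
    \<and> (\<rho> \<ge> 1 \<and> \<delta> = pi / \<rho> \<longrightarrow>
      (\<lambda>r. K_Re' \<rho> \<mu> r t \<theta>) integrable_on {1 + \<epsilon>..} \<and>
      (\<lambda>\<phi>. P_Re \<rho> \<mu> (1 + \<epsilon>) \<phi> t \<theta>) integrable_on {- (pi / \<rho>) - pi..pi / \<rho> - pi} \<and>
      (\<lambda>r. K_Im' \<rho> \<mu> r t \<theta>) integrable_on {1 + \<epsilon>..} \<and>
      (\<lambda>\<phi>. P_Im \<rho> \<mu> (1 + \<epsilon>) \<phi> t \<theta>) integrable_on {- (pi / \<rho>) - pi..pi / \<rho> - pi} \<and>
      mittag_leffler \<rho> \<mu> z =
        complex_of_real
          (integral {1 + \<epsilon>..} (\<lambda>r. K_Re' \<rho> \<mu> r t \<theta>)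
           + integral {- (pi / \<rho>) - pi..pi / \<rho> - pi} (\<lambda>\<phi>. P_Re \<rho> \<mu> (1 + \<epsilon>) \<phi> t \<theta>))
        + \<i> * complex_of_real
          (integral {1 + \<epsilon>..} (\<lambda>r. K_Im' \<rho> \<mu> r t \<theta>)
           + integral {- (pi / \<rho>) - pi..pi / \<rho> - pi} (\<lambda>\<phi>. P_Im \<rho> \<mu> (1 + \<epsilon>) \<phi> t \<theta>)))"
proof -
  have \<rho>: "\<rho> > 0" using assms(1) by simp
  have z: "z = of_real t * cis \<theta>" using assms(3) by (simp add: cis_conv_exp)
  note main = mittag_leffler_real_integrals[OF \<rho> assms(2,5,6,7), of \<mu>, folded z]
  show ?thesis
    unfolding K_prime_eq_K_pi_div[OF \<rho>] using main by (intro conjI[of "_ \<longrightarrow> _"] impI) auto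
qed

end
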